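(* Let $G$ be a second countable locally compact group, let $a\in G$ be an aperiodic element, let $w$ be a weight on $G$ with $w,w^{-1}\in L^\infty(G)$, and let $\Phi$ be a $\Delta_2$-regular Young function. Let $T_{a,w}$ be the weighted translation $T_{a,w}f(x)=w(x)f(xa^{-1})$ on the Orlicz space $L^\Phi(G)$. For $n\in\mathbb{N}$ and $x\in G$ put $$\varphi_{n}(x)=\prod_{j=1}^{n}w(xa^{j}),\qquad \widetilde{\varphi}_{n}(x)=\Big(\prod_{j=0}^{n-1}w(xa^{-j})\Big)^{-1}.$$ Then the following conditions are equivalent. (i) $T_{a,w}$ is topologically multiply recurrent on $L^\Phi(G)$. (ii) For each $L\in\mathbb{N}$ and each compact subset $K\subset G$ with $\lambda(K)>0$, there exist a sequence $(E_k)$ of Borel subsets of $K$ and a strictly increasing sequence $(n_k)$ of positive integers such that $\lambda(K)=\lim_{k\to\infty}\lambda(E_k)$ and, for every $1\le l\le L$, $$\lim_{k\to\infty}\big\|\varphi_{ln_k}|_{E_k}\big\|_\infty=\lim_{k\to\infty}\big\|\widetilde{\varphi}_{ln_k}|_{E_k}\big\|_\infty=0.$$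
   Context: Locally compact groups are Hausdorff; $\lambda$ is a right Haar measure on $G$; $\mathbb{N}$ is the set of positive integers. An element $a\in G$ is aperiodic if the closed subgroup of $G$ generated by $a$ is not compact. A Young function is a continuous, even, convex function $\Phi:\mathbb{R}\to\mathbb{R}$ with $\Phi(0)=0$, $\Phi(t)>0$ for $t>0$, and $\lim_{t\to\infty}\Phi(t)=\infty$. It is $\Delta_2$-regular (relative to $G$) if there is a constant $M>0$ such that $\Phi(2t)\le M\Phi(t)$ for all $t>0$ when $G$ is noncompact; when $G$ is compact, it is only required that there exist $M>0$ and $t_0>0$ with $\Phi(2t)\le M\Phi(t)$ for all $t\ge t_0$. The Orlicz space $L^\Phi(G)$ is the Banach space of ($\lambda$-a.e. classes of) Borel measurable functions $f:G\to\mathbb{C}$ with $\int_G\Phi(\alpha|f|)\,d\lambda<\infty$ for some $\alpha>0$, with the Luxemburg norm $N_\Phi(f)=\inf\{k>0:\int_G\Phi(|f|/k)\,d\lambda\le 1\}$. A weight on $G$ is a bounded continuous function $w:G\to(0,\infty)$. An operator $T$ on a Banach space $X$ is topologically multiply recurrent if for every positive integer $L$ and every nonempty open $U\subset X$ there is $n\in\mathbb{N}$ with $U\cap T^{-n}U\cap T^{-2n}U\cap\cdots\cap T^{-Ln}U\neq\emptyset$. *)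

theory Defs
  imports "HOL-Probability.Essential_Supremum"
begin

text \<open>
  Groups are rendered by the library class \<^class>\<open>topological_group_add\<close>, which is written
  additively but is \<^emph>\<open>not\<close> assumed commutative: the product \<open>x a\<close> is \<open>x + a\<close>, the quotient
  \<open>x a\<^sup>-\<^sup>1\<close> is \<open>x - a\<close> (that is, \<open>x + (- a)\<close>), and the identity is \<open>0\<close>.
\<close>

definition gpow :: "'g::monoid_add \<Rightarrow> nat \<Rightarrow> 'g" where
  "gpow a j = ((+) a ^^ j) 0"

definition is_subgroup :: "'g::group_add set \<Rightarrow> bool" where
  "is_subgroup H \<longleftrightarrow> 0 \<in> H \<and> (\<forall>x\<in>H. \<forall>y\<in>H. x + y \<in> H) \<and> (\<forall>x\<in>H. - x \<in> H)"

definition closed_subgroup_generated :: "'g::topological_group_add \<Rightarrow> 'g set" where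
  "closed_subgroup_generated a = (\<lambda>H. closed H \<and> is_subgroup H) hull {a}"

definition aperiodic :: "'g::topological_group_add \<Rightarrow> bool" where
  "aperiodic a \<longleftrightarrow> \<not> compact (closed_subgroup_generated a)"

text \<open>
  The two regularity clauses are part of the usual definition of a Haar measure as a Radon
  measure; for second countable groups they follow from the others.
\<close>

definition right_haar_measure :: "'g::topological_group_add measure \<Rightarrow> bool" where
  "right_haar_measure M \<longleftrightarrow>
     sets M = sets borel \<and>
     emeasure M UNIV \<noteq> 0 \<and>
     (\<forall>K. compact K \<longrightarrow> emeasure M K < \<infinity>) \<and>
     (\<forall>B\<in>sets borel. emeasure M B = (INF U\<in>{U. open U \<and> B \<subseteq> U}. emeasure M U)) \<and>
     (\<forall>U. open U \<longrightarrow> emeasure M U = (SUP K\<in>{K. compact K \<and> K \<subseteq> U}. emeasure M K)) \<and>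
     (\<forall>B\<in>sets borel. \<forall>g. emeasure M ((\<lambda>x. x + g) ` B) = emeasure M B)"

definition young_function :: "(real \<Rightarrow> real) \<Rightarrow> bool" where
  "young_function \<Phi> \<longleftrightarrow>
     continuous_on UNIV \<Phi> \<and> (\<forall>t. \<Phi> (- t) = \<Phi> t) \<and> convex_on UNIV \<Phi> \<and>
     \<Phi> 0 = 0 \<and> (\<forall>t>0. \<Phi> t > 0) \<and> filterlim \<Phi> at_top at_top"

definition delta2_regular :: "'g::topological_space itself \<Rightarrow> (real \<Rightarrow> real) \<Rightarrow> bool" where
  "delta2_regular G \<Phi> \<longleftrightarrow>
     (if compact (UNIV :: 'g set)
      then \<exists>M>0. \<exists>t0>0. \<forall>t\<ge>t0. \<Phi> (2 * t) \<le> M * \<Phi> t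
      else \<exists>M>0. \<forall>t>0. \<Phi> (2 * t) \<le> M * \<Phi> t)"

definition orlicz_fun :: "'a measure \<Rightarrow> (real \<Rightarrow> real) \<Rightarrow> ('a \<Rightarrow> complex) set" where
  "orlicz_fun M \<Phi> =
     {f \<in> borel_measurable M. \<exists>\<alpha>>0. (\<integral>\<^sup>+ x. ennreal (\<Phi> (\<alpha> * cmod (f x))) \<partial>M) < \<infinity>}"

definition luxemburg_norm :: "'a measure \<Rightarrow> (real \<Rightarrow> real) \<Rightarrow> ('a \<Rightarrow> complex) \<Rightarrow> real" where
  "luxemburg_norm M \<Phi> f =
     Inf {k. k > 0 \<and> (\<integral>\<^sup>+ x. ennreal (\<Phi> (cmod (f x) / k)) \<partial>M) \<le> 1}"

definition orlicz_rel ::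
    "'a measure \<Rightarrow> (real \<Rightarrow> real) \<Rightarrow> (('a \<Rightarrow> complex) \<times> ('a \<Rightarrow> complex)) set" where
  "orlicz_rel M \<Phi> =
     {(f, g). f \<in> orlicz_fun M \<Phi> \<and> g \<in> orlicz_fun M \<Phi> \<and> (AE x in M. f x = g x)}"

definition orlicz_space :: "'a measure \<Rightarrow> (real \<Rightarrow> real) \<Rightarrow> ('a \<Rightarrow> complex) set set" where
  "orlicz_space M \<Phi> = orlicz_fun M \<Phi> // orlicz_rel M \<Phi>"

text \<open>
  The set passed to \<^const>\<open>the_elem\<close> is a singleton, because the Luxemburg norm of the difference
  does not depend on the representatives. The value outside the space is a dummy: the locale
  \<^locale>\<open>Metric_space\<close> asks for symmetry and nonnegativity on the whole type.
\<close>

definition orlicz_dist ::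
    "'a measure \<Rightarrow> (real \<Rightarrow> real) \<Rightarrow> ('a \<Rightarrow> complex) set \<Rightarrow> ('a \<Rightarrow> complex) set \<Rightarrow> real" where
  "orlicz_dist M \<Phi> F H =
     (if F \<in> orlicz_space M \<Phi> \<and> H \<in> orlicz_space M \<Phi>
      then the_elem (\<Union>f\<in>F. \<Union>h\<in>H. {luxemburg_norm M \<Phi> (\<lambda>x. f x - h x)}) else 0)"

definition orlicz_topology :: "'a measure \<Rightarrow> (real \<Rightarrow> real) \<Rightarrow> ('a \<Rightarrow> complex) set topology" where
  "orlicz_topology M \<Phi> = Metric_space.mtopology (orlicz_space M \<Phi>) (orlicz_dist M \<Phi>)"

definition Linf_norm :: "'a measure \<Rightarrow> ('a \<Rightarrow> real) \<Rightarrow> ennreal" where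
  "Linf_norm M f = esssup M (\<lambda>x. ennreal \<bar>f x\<bar>)"

definition Linf :: "'a measure \<Rightarrow> ('a \<Rightarrow> real) set" where
  "Linf M = {f \<in> borel_measurable M. Linf_norm M f < \<infinity>}"

definition weight :: "('g::topological_space \<Rightarrow> real) \<Rightarrow> bool" where
  "weight w \<longleftrightarrow> continuous_on UNIV w \<and> bounded (range w) \<and> (\<forall>x. w x > 0)"

definition weighted_translation ::
    "'g::group_add \<Rightarrow> ('g \<Rightarrow> real) \<Rightarrow> ('g \<Rightarrow> complex) \<Rightarrow> 'g \<Rightarrow> complex" where
  "weighted_translation a w f = (\<lambda>x. complex_of_real (w x) * f (x - a))"

text \<open>The operator induced by \<^const>\<open>weighted_translation\<close> on almost-everywhere classes.\<close>

definition orlicz_translation ::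
    "'g::group_add measure \<Rightarrow> (real \<Rightarrow> real) \<Rightarrow> 'g \<Rightarrow> ('g \<Rightarrow> real)
      \<Rightarrow> ('g \<Rightarrow> complex) set \<Rightarrow> ('g \<Rightarrow> complex) set" where
  "orlicz_translation M \<Phi> a w F = (\<Union>f\<in>F. orlicz_rel M \<Phi> `` {weighted_translation a w f})"

definition multiply_recurrent :: "'x topology \<Rightarrow> ('x \<Rightarrow> 'x) \<Rightarrow> bool" where
  "multiply_recurrent X T \<longleftrightarrow>
     (\<forall>L>0. \<forall>U. openin X U \<and> U \<noteq> {} \<longrightarrow>
        (\<exists>n>0. (\<Inter>l\<in>{0..L::nat}. {x \<in> topspace X. (T ^^ (l * n)) x \<in> U}) \<noteq> {}))"

definition weight_prod :: "'g::group_add \<Rightarrow> ('g \<Rightarrow> real) \<Rightarrow> nat \<Rightarrow> 'g \<Rightarrow> real" where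
  "weight_prod a w n x = (\<Prod>j=1..n. w (x + gpow a j))"

definition weight_prod_tilde :: "'g::group_add \<Rightarrow> ('g \<Rightarrow> real) \<Rightarrow> nat \<Rightarrow> 'g \<Rightarrow> real" where
  "weight_prod_tilde a w n x = inverse (\<Prod>j=0..<n. w (x - gpow a j))"

section \<open>Well-definedness of the quotient constructions\<close>

lemma young_nonneg: "young_function \<Phi> \<Longrightarrow> 0 \<le> \<Phi> t"
  unfolding young_function_def
  by (metis less_eq_real_def linorder_less_linear neg_0_less_iff_less)

lemma young_scale:
  assumes "young_function \<Phi>" "0 \<le> s" "0 \<le> c" "c \<le> 1"
  shows "\<Phi> (c * s) \<le> c * \<Phi> s"
proof -
  have "convex_on UNIV \<Phi>" "\<Phi> 0 = 0" using assms(1) by (auto simp: young_function_def)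
  then show ?thesis using convex_onD[of UNIV \<Phi> c 0 s] assms by simp
qed

lemma young_mono:
  assumes "young_function \<Phi>" "0 \<le> s" "s \<le> t"
  shows "\<Phi> s \<le> \<Phi> t"
proof (cases "t = 0")
  case False
  then have "t > 0" using assms by simp
  then have "\<Phi> (s / t * t) \<le> s / t * \<Phi> t"
    using assms by (intro young_scale) auto
  also have "\<dots> \<le> 1 * \<Phi> t"
    using assms \<open>t > 0\<close> young_nonneg by (intro mult_right_mono) auto
  finally show ?thesis using \<open>t > 0\<close> by simp
qed (use assms in auto)

lemma young_measurable: "young_function \<Phi> \<Longrightarrow> \<Phi> \<in> borel_measurable borel"
  by (auto simp: young_function_def intro: borel_measurable_continuous_onI)

definition modular_set :: "'a measure \<Rightarrow> (real \<Rightarrow> real) \<Rightarrow> ('a \<Rightarrow> complex) \<Rightarrow> real set" where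
  "modular_set M \<Phi> f = {k. k > 0 \<and> (\<integral>\<^sup>+ x. ennreal (\<Phi> (cmod (f x) / k)) \<partial>M) \<le> 1}"

lemma modular_set_up:
  assumes "young_function \<Phi>" "k \<in> modular_set M \<Phi> f" "k \<le> k'"
  shows "k' \<in> modular_set M \<Phi> f"
proof -
  have "(\<integral>\<^sup>+ x. ennreal (\<Phi> (cmod (f x) / k')) \<partial>M) \<le> (\<integral>\<^sup>+ x. ennreal (\<Phi> (cmod (f x) / k)) \<partial>M)"
  proof (intro nn_integral_mono ennreal_leI young_mono[OF assms(1)])
    fix x
    have "0 < k" "0 < k'" using assms(2,3) by (auto simp: modular_set_def)
    then show "0 \<le> cmod (f x) / k'" "cmod (f x) / k' \<le> cmod (f x) / k"
      using assms(3) by (auto intro!: divide_left_mono)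
  qed
  then show ?thesis using assms by (auto simp: modular_set_def)
qed

lemma modular_set_nonempty:
  assumes Y: "young_function \<Phi>" and f: "f \<in> orlicz_fun M \<Phi>"
  shows "modular_set M \<Phi> f \<noteq> {}"
proof -
  from f obtain \<alpha> where [measurable]: "f \<in> borel_measurable M" and a: "\<alpha> > 0"
    and fin: "(\<integral>\<^sup>+ x. ennreal (\<Phi> (\<alpha> * cmod (f x))) \<partial>M) < \<infinity>" by (auto simp: orlicz_fun_def)
  note [measurable] = young_measurable[OF Y]
  define I where "I = (\<integral>\<^sup>+ x. ennreal (\<Phi> (\<alpha> * cmod (f x))) \<partial>M)"
  define c where "c = 1 / (enn2real I + 1)"
  have nn: "0 \<le> enn2real I" by simp
  then have nz: "enn2real I + 1 > 0" by linarith
  have c: "0 < c" unfolding c_def using nz by (intro divide_pos_pos) auto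
  have c1: "c * (enn2real I + 1) = 1" unfolding c_def using nz by simp
  have c2: "c * enn2real I \<le> 1" using c c1 by (simp only: distrib_left mult_1_right)
  have c3: "c \<le> 1" unfolding c_def using nz nn by (simp only: divide_le_eq_1) simp
  have "(\<integral>\<^sup>+ x. ennreal (\<Phi> (cmod (f x) / (1 / (c * \<alpha>)))) \<partial>M)
     \<le> (\<integral>\<^sup>+ x. ennreal c * ennreal (\<Phi> (\<alpha> * cmod (f x))) \<partial>M)"
  proof (intro nn_integral_mono)
    fix x
    have "\<Phi> (c * (\<alpha> * cmod (f x))) \<le> c * \<Phi> (\<alpha> * cmod (f x))"
      using c c3 a Y by (intro young_scale) auto
    then have "ennreal (\<Phi> (c * (\<alpha> * cmod (f x)))) \<le> ennreal (c * \<Phi> (\<alpha> * cmod (f x)))"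
      by (rule ennreal_leI)
    moreover have "cmod (f x) / (1 / (c * \<alpha>)) = c * (\<alpha> * cmod (f x))" by simp
    moreover have "ennreal c * ennreal (\<Phi> (\<alpha> * cmod (f x))) = ennreal (c * \<Phi> (\<alpha> * cmod (f x)))"
      using c young_nonneg[OF Y] by (intro ennreal_mult[symmetric]) auto
    ultimately show "ennreal (\<Phi> (cmod (f x) / (1 / (c * \<alpha>)))) \<le> ennreal c * ennreal (\<Phi> (\<alpha> * cmod (f x)))"
      by (simp only:)
  qed
  also have "\<dots> = ennreal c * I" unfolding I_def by (intro nn_integral_cmult) measurable
  also have "\<dots> \<le> 1"
  proof -
    have I: "I = ennreal (enn2real I)" using fin by (simp add: I_def)
    have "ennreal c * ennreal (enn2real I) = ennreal (c * enn2real I)"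
      using c nn by (intro ennreal_mult[symmetric]) auto
    also have "\<dots> \<le> ennreal 1" using c2 by (rule ennreal_leI)
    finally show ?thesis unfolding I[symmetric] by simp
  qed
  finally have "1 / (c * \<alpha>) \<in> modular_set M \<Phi> f" using a c by (simp add: modular_set_def)
  then show ?thesis by auto
qed

lemma modular_set_diff:
  assumes Y: "young_function \<Phi>" and k: "k \<in> modular_set M \<Phi> f" "l \<in> modular_set M \<Phi> g"
    and [measurable]: "f \<in> borel_measurable M" "g \<in> borel_measurable M"
    and le: "\<And>x. cmod (h x) \<le> cmod (f x) + cmod (g x)"
  shows "k + l \<in> modular_set M \<Phi> h"
proof -
  note [measurable] = young_measurable[OF Y]
  have kl: "k > 0" "l > 0" using k by (auto simp: modular_set_def)
  define c where "c = l / (k + l)"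
  have c: "0 \<le> c" "c \<le> 1" "1 - c = k / (k + l)" using kl by (auto simp: c_def divide_simps)
  have "(\<integral>\<^sup>+ x. ennreal (\<Phi> (cmod (h x) / (k + l))) \<partial>M)
     \<le> (\<integral>\<^sup>+ x. ennreal (1 - c) * ennreal (\<Phi> (cmod (f x) / k)) + ennreal c * ennreal (\<Phi> (cmod (g x) / l)) \<partial>M)"
  proof (intro nn_integral_mono)
    fix x
    have "\<Phi> (cmod (h x) / (k + l)) \<le> \<Phi> ((cmod (f x) + cmod (g x)) / (k + l))"
      using le kl by (intro young_mono[OF Y] divide_right_mono) auto
    also have "(cmod (f x) + cmod (g x)) / (k + l) = (1 - c) * (cmod (f x) / k) + c * (cmod (g x) / l)"
      unfolding c(3) unfolding c_def using kl
      by (simp add: add_divide_distrib)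
    also have "\<Phi> \<dots> \<le> (1 - c) * \<Phi> (cmod (f x) / k) + c * \<Phi> (cmod (g x) / l)"
      using convex_onD[of UNIV \<Phi> c "cmod (f x) / k" "cmod (g x) / l"] Y c
      by (simp add: young_function_def)
    finally show "ennreal (\<Phi> (cmod (h x) / (k + l))) \<le>
       ennreal (1 - c) * ennreal (\<Phi> (cmod (f x) / k)) + ennreal c * ennreal (\<Phi> (cmod (g x) / l))"
      using c(1,2) young_nonneg[OF Y]
      by (simp add: ennreal_mult[symmetric] ennreal_plus[symmetric] ennreal_leI del: ennreal_plus)
  qed
  also have "\<dots> = ennreal (1 - c) * (\<integral>\<^sup>+ x. ennreal (\<Phi> (cmod (f x) / k)) \<partial>M)
      + ennreal c * (\<integral>\<^sup>+ x. ennreal (\<Phi> (cmod (g x) / l)) \<partial>M)"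
    by (subst nn_integral_add) (auto simp: nn_integral_cmult)
  also have "\<dots> \<le> ennreal (1 - c) * 1 + ennreal c * 1"
    using k by (intro add_mono mult_left_mono) (auto simp: modular_set_def)
  also have "\<dots> = 1" using c by (simp add: ennreal_plus[symmetric] del: ennreal_plus)
  finally show ?thesis using kl by (auto simp: modular_set_def)
qed

lemma lux_eq: "luxemburg_norm M \<Phi> f = Inf (modular_set M \<Phi> f)"
  by (simp add: luxemburg_norm_def modular_set_def)

lemma modular_set_bdd: "bdd_below (modular_set M \<Phi> f)"
  by (rule bdd_belowI[of _ 0]) (auto simp: modular_set_def)

lemma lux_cong_AE:
  "AE x in M. f x = g x \<Longrightarrow> luxemburg_norm M \<Phi> f = luxemburg_norm M \<Phi> g"
proof -
  assume *: "AE x in M. f x = g x"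
  have "(\<integral>\<^sup>+ x. ennreal (\<Phi> (cmod (f x) / k)) \<partial>M) = (\<integral>\<^sup>+ x. ennreal (\<Phi> (cmod (g x) / k)) \<partial>M)" for k
    using * by (intro nn_integral_cong_AE) auto
  then show ?thesis by (simp add: luxemburg_norm_def)
qed

lemma orlicz_diff:
  assumes Y: "young_function \<Phi>" and f: "f \<in> orlicz_fun M \<Phi>" and g: "g \<in> orlicz_fun M \<Phi>"
  shows "(\<lambda>x. f x - g x) \<in> orlicz_fun M \<Phi>"
proof -
  obtain k l where kl: "k \<in> modular_set M \<Phi> f" "l \<in> modular_set M \<Phi> g"
    using modular_set_nonempty[OF Y] f g by blast
  have m[measurable]: "f \<in> borel_measurable M" "g \<in> borel_measurable M"
    using f g by (auto simp: orlicz_fun_def)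
  have "k + l \<in> modular_set M \<Phi> (\<lambda>x. f x - g x)"
    by (rule modular_set_diff[OF Y kl m]) (rule norm_triangle_ineq4)
  then have "k + l > 0" "(\<integral>\<^sup>+ x. ennreal (\<Phi> (1 / (k + l) * cmod (f x - g x))) \<partial>M) < \<infinity>"
    by (auto simp: modular_set_def intro: order.strict_trans1)
  then show ?thesis unfolding orlicz_fun_def by (auto intro!: exI[of _ "1 / (k + l)"])
qed

lemma lux_zero:
  assumes Y: "young_function \<Phi>" and f: "f \<in> orlicz_fun M \<Phi>" and 0: "luxemburg_norm M \<Phi> f = 0"
  shows "AE x in M. f x = 0"
proof -
  have [measurable]: "f \<in> borel_measurable M" using f by (auto simp: orlicz_fun_def)
  note [measurable] = young_measurable[OF Y]
  have k: "k \<in> modular_set M \<Phi> f" if "k > 0" for k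
  proof -
    have "\<exists>k'\<in>modular_set M \<Phi> f. k' < k"
      using 0 that modular_set_nonempty[OF Y f] by (intro cInf_lessD) (auto simp: lux_eq)
    then obtain k' where "k' \<in> modular_set M \<Phi> f" "k' < k" by blast
    then show ?thesis using modular_set_up[OF Y] by fastforce
  qed
  let ?I = "\<integral>\<^sup>+ x. ennreal (\<Phi> (cmod (f x))) \<partial>M"
  have le: "?I \<le> ennreal c" if c: "c > 0" "c \<le> 1" for c
  proof -
    have "?I \<le> (\<integral>\<^sup>+ x. ennreal c * ennreal (\<Phi> (cmod (f x) / c)) \<partial>M)"
    proof (intro nn_integral_mono)
      fix x
      have "\<Phi> (c * (cmod (f x) / c)) \<le> c * \<Phi> (cmod (f x) / c)"
        using c by (intro young_scale[OF Y]) auto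
      moreover have "c * (cmod (f x) / c) = cmod (f x)" using c by simp
      ultimately have "ennreal (\<Phi> (cmod (f x))) \<le> ennreal (c * \<Phi> (cmod (f x) / c))"
        by (metis ennreal_leI)
      also have "\<dots> = ennreal c * ennreal (\<Phi> (cmod (f x) / c))"
        using c young_nonneg[OF Y] by (intro ennreal_mult) auto
      finally show "ennreal (\<Phi> (cmod (f x))) \<le> ennreal c * ennreal (\<Phi> (cmod (f x) / c))" .
    qed
    also have "\<dots> = ennreal c * (\<integral>\<^sup>+ x. ennreal (\<Phi> (cmod (f x) / c)) \<partial>M)"
      by (intro nn_integral_cmult) measurable
    also have "\<dots> \<le> ennreal c * 1" using k[OF c(1)] by (intro mult_left_mono) (auto simp: modular_set_def)
    finally show ?thesis by simp
  qed
  have "?I = 0"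
  proof (rule ccontr)
    assume "?I \<noteq> 0"
    define r where "r = enn2real ?I"
    have "?I \<le> ennreal 1" by (rule le) auto
    also have "\<dots> < \<infinity>" by simp
    finally have fin: "?I = ennreal r" unfolding r_def by simp
    have "r \<noteq> 0" using fin \<open>?I \<noteq> 0\<close> by (metis ennreal_0)
    moreover have "0 \<le> r" by (simp add: r_def)
    ultimately have p: "r > 0" by linarith
    have "?I \<le> ennreal (min 1 (r / 2))" using p by (intro le) auto
    then have "ennreal r \<le> ennreal (min 1 (r / 2))" by (simp only: fin)
    then have "r \<le> min 1 (r / 2)" using p by (subst (asm) ennreal_le_iff) auto
    then show False using p by linarith
  qed
  then have "AE x in M. ennreal (\<Phi> (cmod (f x))) = 0"
    by (subst nn_integral_0_iff_AE[symmetric]) auto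
  then show ?thesis
  proof (rule AE_mp, intro AE_I2 impI)
    fix x assume "ennreal (\<Phi> (cmod (f x))) = 0"
    then have "\<not> \<Phi> (cmod (f x)) > 0" by (metis ennreal_eq_0_iff not_less)
    moreover have "\<forall>t>0. \<Phi> t > 0" using Y by (simp add: young_function_def)
    ultimately have "\<not> cmod (f x) > 0" by blast
    then show "f x = 0" by simp
  qed
qed

lemma equiv_orlicz: "equiv (orlicz_fun M \<Phi>) (orlicz_rel M \<Phi>)"
proof (rule equivI)
  show "trans (orlicz_rel M \<Phi>)"
  proof (rule transI)
    fix f g h assume *: "(f, g) \<in> orlicz_rel M \<Phi>" "(g, h) \<in> orlicz_rel M \<Phi>"
    then have "AE x in M. f x = g x" "AE x in M. g x = h x" by (auto simp: orlicz_rel_def)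
    then have "AE x in M. f x = h x" by eventually_elim simp
    then show "(f, h) \<in> orlicz_rel M \<Phi>" using * by (auto simp: orlicz_rel_def)
  qed
next
  show "sym (orlicz_rel M \<Phi>)"
    by (rule symI) (simp add: orlicz_rel_def eq_commute)
qed (auto simp: refl_on_def orlicz_rel_def)

lemma orlicz_dist_class:
  assumes "f \<in> orlicz_fun M \<Phi>" "h \<in> orlicz_fun M \<Phi>"
  shows "orlicz_dist M \<Phi> (orlicz_rel M \<Phi> `` {f}) (orlicz_rel M \<Phi> `` {h}) =
    luxemburg_norm M \<Phi> (\<lambda>x. f x - h x)"
proof -
  have "luxemburg_norm M \<Phi> (\<lambda>x. f' x - h' x) = luxemburg_norm M \<Phi> (\<lambda>x. f x - h x)"
    if "f' \<in> orlicz_rel M \<Phi> `` {f}" "h' \<in> orlicz_rel M \<Phi> `` {h}" for f' h'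
  proof (rule lux_cong_AE)
    from that have "AE x in M. f x = f' x" "AE x in M. h x = h' x" by (auto simp: orlicz_rel_def)
    then show "AE x in M. f' x - h' x = f x - h x" by eventually_elim simp
  qed
  moreover have "f \<in> orlicz_rel M \<Phi> `` {f}" "h \<in> orlicz_rel M \<Phi> `` {h}"
    using assms by (auto simp: orlicz_rel_def)
  ultimately have "(\<Union>f'\<in>orlicz_rel M \<Phi> `` {f}. \<Union>h'\<in>orlicz_rel M \<Phi> `` {h}.
      {luxemburg_norm M \<Phi> (\<lambda>x. f' x - h' x)}) = {luxemburg_norm M \<Phi> (\<lambda>x. f x - h x)}"
    by blast
  moreover have "orlicz_rel M \<Phi> `` {f} \<in> orlicz_space M \<Phi>" "orlicz_rel M \<Phi> `` {h} \<in> orlicz_space M \<Phi>"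
    using assms unfolding orlicz_space_def by (auto intro: quotientI)
  ultimately show ?thesis unfolding orlicz_dist_def by (simp only: simp_thms if_True the_elem_eq)
qed

lemma orlicz_space_cases:
  assumes "F \<in> orlicz_space M \<Phi>"
  obtains f where "f \<in> orlicz_fun M \<Phi>" "F = orlicz_rel M \<Phi> `` {f}"
  using assms by (auto simp: orlicz_space_def elim: quotientE)

lemma lux_nonneg:
  assumes "young_function \<Phi>" "f \<in> orlicz_fun M \<Phi>"
  shows "0 \<le> luxemburg_norm M \<Phi> f"
  unfolding lux_eq using modular_set_nonempty[OF assms]
  by (intro cInf_greatest) (auto simp: modular_set_def)

lemma Metric_space_orlicz:
  assumes Y: "young_function \<Phi>"
  shows "Metric_space (orlicz_space M \<Phi>) (orlicz_dist M \<Phi>)"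
proof
  fix F H
  show "0 \<le> orlicz_dist M \<Phi> F H"
  proof (cases "F \<in> orlicz_space M \<Phi> \<and> H \<in> orlicz_space M \<Phi>")
    case True
    then obtain f h where "f \<in> orlicz_fun M \<Phi>" "F = orlicz_rel M \<Phi> `` {f}"
      "h \<in> orlicz_fun M \<Phi>" "H = orlicz_rel M \<Phi> `` {h}" by (metis orlicz_space_cases)
    then show ?thesis by (simp add: orlicz_dist_class lux_nonneg[OF Y] orlicz_diff[OF Y])
  qed (auto simp: orlicz_dist_def)
  show "orlicz_dist M \<Phi> F H = orlicz_dist M \<Phi> H F"
  proof (cases "F \<in> orlicz_space M \<Phi> \<and> H \<in> orlicz_space M \<Phi>")
    case True
    then obtain f h where "f \<in> orlicz_fun M \<Phi>" "F = orlicz_rel M \<Phi> `` {f}"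
      "h \<in> orlicz_fun M \<Phi>" "H = orlicz_rel M \<Phi> `` {h}" by (metis orlicz_space_cases)
    then show ?thesis by (simp add: orlicz_dist_class luxemburg_norm_def norm_minus_commute)
  qed (auto simp: orlicz_dist_def)
next
  fix F H assume "F \<in> orlicz_space M \<Phi>" "H \<in> orlicz_space M \<Phi>"
  then obtain f h where f: "f \<in> orlicz_fun M \<Phi>" "F = orlicz_rel M \<Phi> `` {f}"
    and h: "h \<in> orlicz_fun M \<Phi>" "H = orlicz_rel M \<Phi> `` {h}" by (metis orlicz_space_cases)
  have eq: "F = H \<longleftrightarrow> (AE x in M. f x = h x)"
    unfolding f(2) h(2) eq_equiv_class_iff[OF equiv_orlicz f(1) h(1)]
    using f(1) h(1) by (simp add: orlicz_rel_def)
  have "\<And>k. \<Phi> (cmod 0 / k) = 0" using Y by (simp add: young_function_def)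
  then have "modular_set M \<Phi> (\<lambda>_. 0) = {0<..}" by (auto simp: modular_set_def)
  then have z: "luxemburg_norm M \<Phi> (\<lambda>_. 0) = 0" by (simp add: lux_eq)
  show "orlicz_dist M \<Phi> F H = 0 \<longleftrightarrow> F = H"
  proof
    assume "orlicz_dist M \<Phi> F H = 0"
    then have "AE x in M. f x - h x = 0"
      using f h by (intro lux_zero[OF Y orlicz_diff[OF Y]]) (auto simp: orlicz_dist_class)
    then show "F = H" unfolding eq by eventually_elim simp
  next
    assume "F = H"
    then have "AE x in M. f x - h x = 0" unfolding eq by eventually_elim simp
    then show "orlicz_dist M \<Phi> F H = 0" using f h z lux_cong_AE[of "\<lambda>x. f x - h x" "\<lambda>_. 0"]
      by (simp add: orlicz_dist_class)
  qed
next
  fix F H J assume "F \<in> orlicz_space M \<Phi>" "H \<in> orlicz_space M \<Phi>" "J \<in> orlicz_space M \<Phi>"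
  then obtain f h j where f: "f \<in> orlicz_fun M \<Phi>" "F = orlicz_rel M \<Phi> `` {f}"
    and h: "h \<in> orlicz_fun M \<Phi>" "H = orlicz_rel M \<Phi> `` {h}"
    and j: "j \<in> orlicz_fun M \<Phi>" "J = orlicz_rel M \<Phi> `` {j}" by (metis orlicz_space_cases)
  have A: "(\<lambda>x. f x - h x) \<in> orlicz_fun M \<Phi>" "(\<lambda>x. h x - j x) \<in> orlicz_fun M \<Phi>"
    using f h j orlicz_diff[OF Y] by auto
  let ?a = "modular_set M \<Phi> (\<lambda>x. f x - h x)" and ?b = "modular_set M \<Phi> (\<lambda>x. h x - j x)"
    and ?c = "modular_set M \<Phi> (\<lambda>x. f x - j x)"
  have *: "Inf ?c \<le> k + l" if "k \<in> ?a" "l \<in> ?b" for k l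
  proof (rule cInf_lower[OF modular_set_diff[OF Y that] modular_set_bdd])
    show "cmod (f x - j x) \<le> cmod (f x - h x) + cmod (h x - j x)" for x
      using norm_triangle_ineq[of "f x - h x" "h x - j x"] by simp
  qed (use A in \<open>auto simp: orlicz_fun_def\<close>)
  have "Inf ?c - l \<le> Inf ?a" if "l \<in> ?b" for l
    using * that modular_set_nonempty[OF Y A(1)] by (intro cInf_greatest) (auto simp: diff_le_eq)
  then have "Inf ?c - Inf ?a \<le> Inf ?b"
    using modular_set_nonempty[OF Y A(2)] by (intro cInf_greatest) (auto simp: algebra_simps)
  then show "orlicz_dist M \<Phi> F J \<le> orlicz_dist M \<Phi> F H + orlicz_dist M \<Phi> H J"
    using f h j by (simp add: orlicz_dist_class lux_eq)
qed

lemma topspace_orlicz: "young_function \<Phi> \<Longrightarrow> topspace (orlicz_topology M \<Phi>) = orlicz_space M \<Phi>"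
  by (simp add: orlicz_topology_def Metric_space.topspace_mtopology Metric_space_orlicz)

lemma orlicz_translation_class:
  fixes lam :: "'g::{topological_group_add, t2_space, second_countable_topology} measure"
  assumes H: "right_haar_measure lam" and w: "weight w" and Y: "young_function \<Phi>"
    and f: "f \<in> orlicz_fun lam \<Phi>"
  shows "orlicz_translation lam \<Phi> a w (orlicz_rel lam \<Phi> `` {f}) =
    orlicz_rel lam \<Phi> `` {weighted_translation a w f}"
    and "weighted_translation a w f \<in> orlicz_fun lam \<Phi>"
proof -
  have sets: "sets lam = sets borel" and sp: "space lam = UNIV"
    using H by (auto simp: right_haar_measure_def dest: sets_eq_imp_space_eq)
  have c1: "continuous_on UNIV (\<lambda>x. x - a)" for a :: 'g
    unfolding diff_conv_add_uminus by (intro continuous_intros)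
  have bm: "(\<lambda>x. x - a) \<in> borel_measurable borel" for a :: 'g
    by (rule borel_measurable_continuous_onI[OF c1])
  then have m[measurable]: "(\<lambda>x. x - a) \<in> measurable lam lam"
    using measurable_cong_sets[OF sets sets] by auto
  have d: "distr lam lam (\<lambda>x. x - a) = lam"
  proof (rule measure_eqI)
    fix A assume "A \<in> sets (distr lam lam (\<lambda>x. x - a))"
    then have A: "A \<in> sets borel" by (simp add: sets)
    have "(\<lambda>x. x - a) -` A = (\<lambda>x. x + a) ` A"
      by (auto simp: image_iff) (metis diff_add_cancel)
    then show "emeasure (distr lam lam (\<lambda>x. x - a)) A = emeasure lam A"
      using A H m by (simp add: emeasure_distr sets sp) (simp add: right_haar_measure_def)
  qed simp
  have wm[measurable]: "w \<in> borel_measurable lam"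
    using w measurable_cong_sets[OF sets refl] by (auto simp: weight_def intro: borel_measurable_continuous_onI)
  have T: "weighted_translation a w g \<in> orlicz_fun lam \<Phi>" if g: "g \<in> orlicz_fun lam \<Phi>" for g
  proof -
    note [measurable] = young_measurable[OF Y]
    obtain \<alpha> where [measurable]: "g \<in> borel_measurable lam" and al: "\<alpha> > 0"
      and fin: "(\<integral>\<^sup>+ x. ennreal (\<Phi> (\<alpha> * cmod (g x))) \<partial>lam) < \<infinity>" using g by (auto simp: orlicz_fun_def)
    obtain C where C: "\<And>x. \<bar>w x\<bar> \<le> C" "C > 0" using w
      by (auto simp: weight_def bounded_pos)
    have "(\<integral>\<^sup>+ x. ennreal (\<Phi> (\<alpha> / C * cmod (weighted_translation a w g x))) \<partial>lam)
      \<le> (\<integral>\<^sup>+ x. ennreal (\<Phi> (\<alpha> * cmod (g (x - a)))) \<partial>lam)"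
    proof (intro nn_integral_mono ennreal_leI young_mono[OF Y])
      fix x
      have "\<alpha> / C * (\<bar>w x\<bar> * cmod (g (x - a))) \<le> \<alpha> / C * (C * cmod (g (x - a)))"
        using C al by (intro mult_left_mono mult_right_mono) auto
      then show "\<alpha> / C * cmod (weighted_translation a w g x) \<le> \<alpha> * cmod (g (x - a))"
        using C by (simp add: weighted_translation_def norm_mult)
    qed (use C al in auto)
    also have "\<dots> = (\<integral>\<^sup>+ x. ennreal (\<Phi> (\<alpha> * cmod (g x))) \<partial>distr lam lam (\<lambda>x. x - a))"
      by (subst nn_integral_distr) auto
    finally have "(\<integral>\<^sup>+ x. ennreal (\<Phi> (\<alpha> / C * cmod (weighted_translation a w g x))) \<partial>lam) < \<infinity>"
      using fin by (simp add: d order.strict_trans1)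
    moreover have "weighted_translation a w g \<in> borel_measurable lam"
      unfolding weighted_translation_def by measurable
    ultimately show ?thesis using al C by (auto simp: orlicz_fun_def intro!: exI[of _ "\<alpha> / C"])
  qed
  show "weighted_translation a w f \<in> orlicz_fun lam \<Phi>" using T f .
  have "orlicz_rel lam \<Phi> `` {weighted_translation a w g} = orlicz_rel lam \<Phi> `` {weighted_translation a w f}"
    if "g \<in> orlicz_rel lam \<Phi> `` {f}" for g
  proof (rule equiv_class_eq[OF equiv_orlicz])
    have g: "g \<in> orlicz_fun lam \<Phi>" and fg: "AE x in lam. f x = g x" using that by (auto simp: orlicz_rel_def)
    have [measurable]: "f \<in> borel_measurable lam" "g \<in> borel_measurable lam"
      using f g by (auto simp: orlicz_fun_def)
    have "AE x in distr lam lam (\<lambda>x. x - a). f x = g x"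
      unfolding d by (rule fg)
    then have "AE x in lam. f (x - a) = g (x - a)"
      by (subst (asm) AE_distr_iff) auto
    then have "AE x in lam. weighted_translation a w g x = weighted_translation a w f x"
      unfolding weighted_translation_def by eventually_elim simp
    then show "(weighted_translation a w g, weighted_translation a w f) \<in> orlicz_rel lam \<Phi>"
      using T[OF f] T[OF g] by (simp add: orlicz_rel_def)
  qed
  then have eq: "\<forall>g\<in>orlicz_rel lam \<Phi> `` {f}.
      orlicz_rel lam \<Phi> `` {weighted_translation a w g} = orlicz_rel lam \<Phi> `` {weighted_translation a w f}"
    by (intro ballI)
  have "f \<in> orlicz_rel lam \<Phi> `` {f}" using f by (simp add: orlicz_rel_def)
  then have "(\<Union>g\<in>orlicz_rel lam \<Phi> `` {f}. orlicz_rel lam \<Phi> `` {weighted_translation a w g}) =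
      orlicz_rel lam \<Phi> `` {weighted_translation a w f}"
    using eq by (rule UN_constant_eq)
  then show "orlicz_translation lam \<Phi> a w (orlicz_rel lam \<Phi> `` {f}) =
    orlicz_rel lam \<Phi> `` {weighted_translation a w f}"
    unfolding orlicz_translation_def .
qed

end

theory Submission
  imports Defs
begin

text \<open>
  Let \<open>T\<close> be the weighted translation and \<open>S\<close> its inverse. Multiplying by \<open>\<phi>\<^sub>m\<close> and then shifting by
  \<open>a\<^sup>m\<close> is \<open>T\<^sup>m\<close>; multiplying by the tilde product and shifting back is \<open>S\<^sup>m\<close>. Since \<open>\<lambda>\<close> is right
  invariant, small weights on \<open>E\<close> make \<open>T\<^sup>m\<close> and \<open>S\<^sup>m\<close> small on functions supported in \<open>E\<close>. Under
  (ii), a bounded \<open>f\<close> with compact support is therefore approximated by a sum of the \<open>S\<^sup>m\<^sup>n(f \<cdot> 1\<^bsub>E\<^esub>)\<close>,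
  \<open>m \<le> L\<close>, and so are the images of that sum under \<open>T\<^sup>l\<^sup>n\<close>.

  Conversely, recurrence of the ball around \<open>1\<^bsub>K\<^esub>\<close> gives \<open>f\<close> with \<open>f\<close> and every \<open>T\<^sup>l\<^sup>n f\<close> near \<open>1\<^bsub>K\<^esub>\<close>.
  Recurrence with \<open>L N\<close> in place of \<open>L\<close> lets \<open>n\<close> be a multiple of \<open>N\<close>, hence so large that \<open>K a\<^sup>l\<^sup>n\<close>
  misses \<open>K\<close>. At most points of \<open>K\<close> the functions are close to 1, while the shifted points lie
  outside \<open>K\<close>, where they are close to 0; the quotient of the two values is the weight product.
\<close>

section \<open>Aperiodic elements\<close>

text \<open>Negative exponents are included because the cyclic subgroup generated by
  \<open>a\<close> also contains the inverses of the powers in \<open>gpow\<close>.\<close>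

definition zpow :: "'g::group_add \<Rightarrow> int \<Rightarrow> 'g" where
  "zpow a k = (if k \<ge> 0 then gpow a (nat k) else - gpow a (nat (- k)))"

lemma gpow_0 [simp]: "gpow a 0 = 0"
  by (simp add: gpow_def)

lemma gpow_Suc: "gpow a (Suc n) = a + gpow a n"
  by (simp add: gpow_def)

lemma gpow_Suc_right: "gpow a (Suc n) = gpow a n + a"
proof (induction n)
  case (Suc n)
  then show ?case by (metis gpow_Suc add.assoc)
qed (simp add: gpow_Suc)

lemma zpow_0 [simp]: "zpow a 0 = 0"
  by (simp add: zpow_def)

lemma zpow_nat [simp]: "zpow a (int n) = gpow a n"
  by (simp add: zpow_def)

lemma zpow_Suc: "zpow a (k + 1) = zpow a k + a"
proof (cases "k \<ge> 0")
  case True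
  then have "nat (k + 1) = Suc (nat k)" by simp
  then show ?thesis using True by (simp add: zpow_def gpow_Suc_right)
next
  case False
  then have "nat (- k) = Suc (nat (- (k + 1)))" by simp
  then show ?thesis using False
    by (cases "k = -1") (auto simp: zpow_def gpow_Suc minus_add add.assoc)
qed

lemma zpow_pred: "zpow a (k - 1) = zpow a k - a"
  using zpow_Suc[of a "k - 1"] by (simp add: add_implies_diff)

lemma zpow_add: "zpow a (m + k) = zpow a m + zpow a k"
proof (induction k rule: int_induct[where k = 0])
  case (step1 i)
  then show ?case using zpow_Suc[of a "m + i"] zpow_Suc[of a i] by (simp add: add.assoc)
next
  case (step2 i)
  then show ?case using zpow_pred[of a "m + i"] zpow_pred[of a i]
    by (simp add: add_diff_eq)
qed simp

lemma zpow_minus: "zpow a (- k) = - zpow a k"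
  using zpow_add[of a "- k" k] by (simp add: eq_neg_iff_add_eq_0)

text \<open>The left quotient is the form used below: when two powers lie in the same translate
  \<open>y + W\<close>, the element \<open>y\<close> cancels from it.\<close>

lemma zpow_diff: "zpow a (m - k) = - zpow a k + zpow a m"
  using zpow_add[of a "- k" m] by (simp add: zpow_minus)

section \<open>Closures of cyclic subgroups\<close>

lemma is_subgroup_closure:
  fixes H :: "'g::topological_group_add set"
  assumes "is_subgroup H"
  shows "is_subgroup (closure H)"
proof -
  have "(\<lambda>p. fst p + snd p) ` closure (H \<times> H) \<subseteq> closure H"
    using assms closure_subset[of H]
    by (intro image_closure_subset continuous_intros) (auto simp: is_subgroup_def)
  then have "x + y \<in> closure H" if "x \<in> closure H" "y \<in> closure H" for x y
    using that by (force simp: closure_Times)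
  moreover have "uminus ` closure H \<subseteq> closure H"
    using assms closure_subset[of H]
    by (intro image_closure_subset continuous_intros) (auto simp: is_subgroup_def)
  ultimately show ?thesis
    using assms closure_subset[of H] unfolding is_subgroup_def by blast
qed

lemma is_subgroup_range_zpow: "is_subgroup (range (zpow a))"
  unfolding is_subgroup_def
proof (intro conjI ballI)
  show "0 \<in> range (zpow a)" by (metis zpow_0 rangeI)
  show "x + y \<in> range (zpow a)" if "x \<in> range (zpow a)" "y \<in> range (zpow a)" for x y
    using that by (auto simp flip: zpow_add)
  show "- x \<in> range (zpow a)" if "x \<in> range (zpow a)" for x
    using that by (auto simp flip: zpow_minus)
qed

text \<open>Otherwise the closure of the powers is a closed subgroup inside \<open>C\<close> that
  contains \<open>a\<close>. The closed subgroup generated by \<open>a\<close> is then a closed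
  subset of a compact set, hence compact.\<close>

lemma zpow_not_in_compact:
  fixes a :: "'g::{topological_group_add, t2_space}"
  assumes "aperiodic a" "compact C"
  shows "\<exists>k. zpow a k \<notin> C"
proof (rule ccontr)
  assume "\<nexists>k. zpow a k \<notin> C"
  then have sub: "closure (range (zpow a)) \<subseteq> C"
    using assms by (intro closure_minimal compact_imp_closed) auto
  have "a = zpow a 1" using zpow_Suc[of a 0] by simp
  then have "a \<in> range (zpow a)" by (rule range_eqI)
  then have "closed_subgroup_generated a \<subseteq> closure (range (zpow a))"
    unfolding closed_subgroup_generated_def using closure_subset[of "range (zpow a)"]
    by (intro hull_minimal) (auto simp: is_subgroup_closure is_subgroup_range_zpow)
  moreover have "closed (closed_subgroup_generated a)"
    unfolding closed_subgroup_generated_def hull_def by (intro closed_Inter) auto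
  ultimately have "compact (C \<inter> closed_subgroup_generated a)"
    using assms by (intro compact_Int_closed) auto
  moreover have "C \<inter> closed_subgroup_generated a = closed_subgroup_generated a"
    using sub \<open>closed_subgroup_generated a \<subseteq> _\<close> by auto
  ultimately show False using assms by (simp add: aperiodic_def)
qed

section \<open>Return times to neighbourhoods of the identity\<close>

lemma open_sub_nbhd:
  fixes W :: "'g::topological_group_add set"
  assumes "open W" "0 \<in> W"
  obtains V where "open V" "0 \<in> V" "\<And>x y. x \<in> V \<Longrightarrow> y \<in> V \<Longrightarrow> - x + y \<in> W"
proof -
  have "open ((\<lambda>p. - fst p + snd p) -` W)"
    using assms by (intro open_vimage continuous_intros)
  moreover have "(0, 0) \<in> (\<lambda>p. - fst p + snd p) -` W" using assms by simp
  ultimately obtain A B where "open A" "open B" "(0, 0) \<in> A \<times> B"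
    and AB: "A \<times> B \<subseteq> (\<lambda>p. - fst p + snd p) -` W" by (rule open_prod_elim)
  then show thesis by (intro that[of "A \<inter> B"]) auto
qed

lemma compact_translate_cover:
  fixes C :: "'g::topological_group_add set"
  assumes "compact C" "open W" "0 \<in> W"
  obtains Y where "finite Y" "\<And>x. x \<in> C \<Longrightarrow> \<exists>y\<in>Y. - y + x \<in> W"
proof -
  have "open ((\<lambda>x. - y + x) -` W)" for y
    using assms by (intro open_vimage continuous_intros)
  moreover have "C \<subseteq> (\<Union>y\<in>C. (\<lambda>x. - y + x) -` W)" using assms by auto
  ultimately obtain Y where "Y \<subseteq> C" "finite Y" "C \<subseteq> (\<Union>y\<in>Y. (\<lambda>x. - y + x) -` W)"
    using compactE_image[OF assms(1), of C "\<lambda>y. (\<lambda>x. - y + x) -` W"] by metis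
  then show thesis by (intro that[of Y]) auto
qed

text \<open>Pigeonhole: finitely many translates \<open>y + V\<close> cover \<open>C\<close>, so one
  of them contains infinitely many powers. Two of these with exponents more than \<open>N\<close>
  apart have their left quotient in \<open>W\<close>.\<close>

lemma gpow_returns_to_nbhd:
  fixes a :: "'g::topological_group_add"
  assumes "compact C" "infinite {n. gpow a n \<in> C}" "open W" "0 \<in> W"
  shows "\<exists>k > N. zpow a k \<in> W"
proof -
  obtain V where V: "open V" "0 \<in> V" "\<And>x y. x \<in> V \<Longrightarrow> y \<in> V \<Longrightarrow> - x + y \<in> W"
    using open_sub_nbhd assms by metis
  obtain Y where Y: "finite Y" "\<And>x. x \<in> C \<Longrightarrow> \<exists>y\<in>Y. - y + x \<in> V"
    using compact_translate_cover[OF assms(1) V(1,2)] by metis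
  have "{n. gpow a n \<in> C} \<subseteq> (\<Union>y\<in>Y. {n. - y + gpow a n \<in> V})" using Y by auto
  then obtain y where "infinite {n. - y + gpow a n \<in> V}"
    using assms(2) Y(1) by (meson finite_UN_I finite_subset)
  then obtain n m where "- y + gpow a n \<in> V" and "m > n + nat N" "- y + gpow a m \<in> V"
    unfolding infinite_nat_iff_unbounded by blast
  then have "- (- y + gpow a n) + (- y + gpow a m) \<in> W" using V by blast
  also have "- (- y + gpow a n) + (- y + gpow a m) = zpow a (int m - int n)"
    by (simp add: zpow_diff minus_add add.assoc)
  finally show ?thesis using \<open>m > n + nat N\<close> by (intro exI[of _ "int m - int n"]) auto
qed

text \<open>A monothetic locally compact group is compact or discrete (Weil): if powers return to a compact
  set infinitely often, they return to a compact neighbourhood of the identity with bounded gaps.\<close>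

lemma finite_gpow_in_compact:
  fixes a :: "'g::{topological_group_add, t2_space}"
  assumes "locally_compact_space (euclidean :: 'g topology)" "aperiodic a" "compact C"
  shows "finite {n. gpow a n \<in> C}"
proof (rule ccontr)
  assume inf: "infinite {n. gpow a n \<in> C}"
  note ret = gpow_returns_to_nbhd[OF assms(3) inf]
  obtain U V :: "'g set" where U: "open U" "0 \<in> U" "U \<subseteq> V" and V: "compact V"
    using assms(1) by (simp add: locally_compact_space_def) metis
  obtain W1 where W1: "open W1" "0 \<in> W1" "\<And>x y. x \<in> W1 \<Longrightarrow> y \<in> W1 \<Longrightarrow> - x + y \<in> U"
    using open_sub_nbhd U by metis
  obtain W where W: "open W" "0 \<in> W" "\<And>x y. x \<in> W \<Longrightarrow> y \<in> W \<Longrightarrow> - x + y \<in> W1"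
    using open_sub_nbhd W1 by metis
  obtain Y where Y: "finite Y" "\<And>x. x \<in> V \<Longrightarrow> \<exists>y\<in>Y. - y + x \<in> W"
    using compact_translate_cover[OF V W(1,2)] by metis
  \<comment> \<open>\<open>m y\<close> is the exponent of one chosen power in \<open>y + W\<close>;
    it is meaningful only for those \<open>y\<close> whose translate contains a power.\<close>
  define m where "m y = (SOME i. - y + zpow a i \<in> W)" for y
  have m: "- y + zpow a (m y) \<in> W" if "- y + zpow a i \<in> W" for y i
    unfolding m_def using that by (rule someI)
  obtain M where M: "\<And>y. y \<in> Y \<Longrightarrow> \<bar>m y\<bar> \<le> M"
    using Y(1) by (metis finite_imageI Max_ge imageI)
  obtain k where k: "k > M" "zpow a k \<in> W1" using ret[OF W1(1,2)] by metis
  define N where "N = k + M"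
  \<comment> \<open>If \<open>zpow a i\<close> lies in \<open>y + W\<close>, then
    \<open>zpow a (m y - i)\<close> lies in \<open>W1\<close>, and comparing it with
    \<open>zpow a k\<close> puts \<open>zpow a (i + (k - m y))\<close> in \<open>U\<close>. Since
    \<bar>\<open>m y\<close>\<bar> \<le> \<open>M\<close> < \<open>k\<close>, the increment
    \<open>k - m y\<close> is between 1 and \<open>k + M\<close>.\<close>
  have gap: "\<exists>n\<in>{1..N}. zpow a (i + n) \<in> V" if i: "zpow a i \<in> V" for i
  proof -
    obtain y where y: "y \<in> Y" "- y + zpow a i \<in> W" using Y i by blast
    have "- (- y + zpow a i) + (- y + zpow a (m y)) \<in> W1"
      using W(3) y m by blast
    also have "- (- y + zpow a i) + (- y + zpow a (m y)) = zpow a (m y - i)"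
      by (simp add: zpow_diff minus_add add.assoc)
    finally have "- zpow a (m y - i) + zpow a k \<in> U" using W1(3) k by blast
    also have "- zpow a (m y - i) + zpow a k = zpow a (i + (k - m y))"
      by (simp flip: zpow_diff) (simp add: algebra_simps)
    finally have "zpow a (i + (k - m y)) \<in> V" using U by auto
    moreover have "k - m y \<in> {1..N}" using M[OF y(1)] k by (auto simp: N_def)
    ultimately show ?thesis by blast
  qed
  \<comment> \<open>From any return \<open>s\<close> on, each window \<open>{i..i + N}\<close>
    contains a return. When the window moves right by one, a return lost at its left end is replaced
    by the next one, at most \<open>N\<close> further on.\<close>
  have up: "\<exists>j\<in>{i..i + N}. zpow a j \<in> V" if "s \<le> i" and s: "zpow a s \<in> V" for s i
    using that(1)
  proof (induction i rule: int_ge_induct)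
    case base
    obtain n where "n \<in> {1..N}" using gap[OF s] by blast
    then show ?case using s by auto
  next
    case (step i)
    then obtain j where j: "j \<in> {i..i + N}" "zpow a j \<in> V" by auto
    show ?case
    proof (cases "j = i")
      case True
      then obtain n where "n \<in> {1..N}" "zpow a (i + n) \<in> V" using gap j by blast
      then show ?thesis by (intro bexI[of _ "i + n"]) auto
    next
      case False
      then show ?thesis using j by auto
    qed
  qed
  \<comment> \<open>The compact set that will contain every power: each power is at most
    \<open>N\<close> steps before a power in \<open>V\<close>.\<close>
  define D where "D = (\<Union>n\<in>{0..N}. (\<lambda>x. x + zpow a (- n)) ` V)"
  have "compact D" unfolding D_def
    by (intro compact_UN compact_continuous_image continuous_intros V) auto
  moreover have "zpow a i \<in> D" for i
  proof -
    \<comment> \<open>The inverse of a late return is a return with a very negative exponent, which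
      gives a starting point to the left of \<open>i\<close>.\<close>
    obtain k where k: "k > \<bar>i\<bar>" "zpow a k \<in> W1" using ret[OF W1(1,2)] by metis
    have "- zpow a k + 0 \<in> U" using W1 k by blast
    then have "zpow a (- k) \<in> V" using U by (auto simp: zpow_minus)
    moreover have "- k \<le> i" using k by simp
    ultimately obtain j where j: "j \<in> {i..i + N}" "zpow a j \<in> V" using up by blast
    have "zpow a i = zpow a j + zpow a (- (j - i))" by (simp flip: zpow_add)
    then show ?thesis unfolding D_def using j by (intro UN_I[of "j - i"]) auto
  qed
  ultimately show False using zpow_not_in_compact[OF assms(2)] by blast
qed

text \<open>If \<open>x\<close> and \<open>x + gpow a n\<close> are both in \<open>K\<close>, then
  \<open>gpow a n\<close> is in the compact set of left quotients \<open>- x + y\<close> of points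
  of \<open>K\<close>, which contains \<open>gpow a n\<close> for only finitely many
  \<open>n\<close>.\<close>

lemma aperiodic_translates_disjoint:
  fixes a :: "'g::{topological_group_add, t2_space}"
  assumes "locally_compact_space (euclidean :: 'g topology)" "aperiodic a" "compact K"
  obtains N where "\<And>n x. n \<ge> N \<Longrightarrow> x \<in> K \<Longrightarrow> x + gpow a n \<notin> K"
    and "\<And>n x. n \<ge> N \<Longrightarrow> x \<in> K \<Longrightarrow> x - gpow a n \<notin> K"
proof -
  define C where "C = (\<lambda>p. - fst p + snd p) ` (K \<times> K)"
  have "compact C" unfolding C_def
    by (intro compact_continuous_image continuous_intros compact_Times assms)
  then have "finite {n. gpow a n \<in> C}" using finite_gpow_in_compact assms by blast
  then obtain N where "\<And>n. gpow a n \<in> C \<Longrightarrow> n < N"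
    by (auto simp: finite_nat_set_iff_bounded)
  then have N: "gpow a n \<notin> C" if "n \<ge> N" for n using that by (meson not_le)
  have C: "gpow a n \<in> C" if "x \<in> K" "x + gpow a n \<in> K" for x n
    unfolding C_def using that by (intro image_eqI[of _ _ "(x, x + gpow a n)"]) auto
  show thesis
  proof
    show "x + gpow a n \<notin> K" if "n \<ge> N" "x \<in> K" for x n using N C that by blast
    show "x - gpow a n \<notin> K" if "n \<ge> N" "x \<in> K" for x n
      using C[of "x - gpow a n" n] N that by auto
  qed
qed

section \<open>Modulars\<close>

lemma modular_set_imp_orlicz:
  assumes "f \<in> borel_measurable M" "k \<in> modular_set M \<Phi> f"
  shows "f \<in> orlicz_fun M \<Phi>"
  using assms unfolding orlicz_fun_def modular_set_def
  by (auto intro!: exI[of _ "1 / k"] intro: order.strict_trans1)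

text \<open>The domination is almost everywhere because the bounds on the weight products come from
  essential suprema.\<close>

lemma modular_set_scale:
  assumes Y: "young_function \<Phi>" and k: "k \<in> modular_set M \<Phi> f" and "c > 0"
    and le: "AE x in M. cmod (h x) \<le> c * cmod (f x)"
  shows "c * k \<in> modular_set M \<Phi> h"
proof -
  have "k > 0" using k by (simp add: modular_set_def)
  have "(\<integral>\<^sup>+ x. ennreal (\<Phi> (cmod (h x) / (c * k))) \<partial>M) \<le> (\<integral>\<^sup>+ x. ennreal (\<Phi> (cmod (f x) / k)) \<partial>M)"
  proof (rule nn_integral_mono_AE, use le in eventually_elim)
    fix x assume "cmod (h x) \<le> c * cmod (f x)"
    then have "cmod (h x) / (c * k) \<le> c * cmod (f x) / (c * k)"
      using \<open>c > 0\<close> \<open>k > 0\<close> by (intro divide_right_mono) auto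
    then show "ennreal (\<Phi> (cmod (h x) / (c * k))) \<le> ennreal (\<Phi> (cmod (f x) / k))"
      using \<open>c > 0\<close> \<open>k > 0\<close> by (intro ennreal_leI young_mono[OF Y]) auto
  qed
  then show ?thesis using k \<open>c > 0\<close> by (auto simp: modular_set_def)
qed

lemma modular_set_add:
  assumes Y: "young_function \<Phi>" and k: "k \<in> modular_set M \<Phi> f" "l \<in> modular_set M \<Phi> g"
    and m: "f \<in> borel_measurable M" "g \<in> borel_measurable M"
  shows "k + l \<in> modular_set M \<Phi> (\<lambda>x. f x + g x)"
  by (rule modular_set_diff[OF Y k m]) (rule norm_triangle_ineq)

text \<open>The separate term \<open>f\<close> starts the induction: members of a
  \<open>modular_set\<close> are positive, so the empty sum could not be given the bound 0.\<close>

lemma modular_set_add_sum: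
  assumes Y: "young_function \<Phi>" and "finite I"
    and "k \<in> modular_set M \<Phi> f" "f \<in> borel_measurable M"
    and "\<And>i. i \<in> I \<Longrightarrow> r i \<in> modular_set M \<Phi> (g i)"
    and "\<And>i. i \<in> I \<Longrightarrow> g i \<in> borel_measurable M"
  shows "k + sum r I \<in> modular_set M \<Phi> (\<lambda>x. f x + (\<Sum>i\<in>I. g i x))"
  using assms(2,5,6)
proof (induction I rule: finite_induct)
  case empty
  then show ?case using assms by simp
next
  case (insert i I)
  have "(k + sum r I) + r i \<in> modular_set M \<Phi> (\<lambda>x. (f x + (\<Sum>i\<in>I. g i x)) + g i x)"
    using insert assms(4)
    by (intro modular_set_add[OF Y, of "k + sum r I" M "\<lambda>x. f x + (\<Sum>i\<in>I. g i x)" "r i" "g i"]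
      borel_measurable_add borel_measurable_sum) auto
  then show ?case using insert by (simp add: add_ac)
qed

lemma lux_less_imp_modular:
  assumes Y: "young_function \<Phi>" and "f \<in> orlicz_fun M \<Phi>" "luxemburg_norm M \<Phi> f < r"
  shows "r \<in> modular_set M \<Phi> f"
proof -
  obtain k where "k \<in> modular_set M \<Phi> f" "k < r"
    using cInf_lessD[OF modular_set_nonempty[OF Y assms(2)], of r] assms(3) by (auto simp: lux_eq)
  then show ?thesis using modular_set_up[OF Y] by fastforce
qed

lemma modular_imp_lux_le: "r \<in> modular_set M \<Phi> f \<Longrightarrow> luxemburg_norm M \<Phi> f \<le> r"
  unfolding lux_eq by (rule cInf_lower[OF _ modular_set_bdd])

text \<open>For a fixed bound \<open>B\<close>, this turns small measure of the support into small
  norm.\<close>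

lemma modular_set_of_bounded:
  assumes Y: "young_function \<Phi>" and "A \<in> sets M" "r > 0" "B \<ge> 0"
    and B: "\<And>x. x \<in> space M \<Longrightarrow> cmod (f x) \<le> B * indicator A x"
    and small: "ennreal (\<Phi> (B / r)) * emeasure M A \<le> 1"
  shows "r \<in> modular_set M \<Phi> f"
proof -
  have "(\<integral>\<^sup>+ x. ennreal (\<Phi> (cmod (f x) / r)) \<partial>M) \<le> (\<integral>\<^sup>+ x. ennreal (\<Phi> (B / r)) * indicator A x \<partial>M)"
  proof (rule nn_integral_mono)
    fix x assume x: "x \<in> space M"
    show "ennreal (\<Phi> (cmod (f x) / r)) \<le> ennreal (\<Phi> (B / r)) * indicator A x"
    proof (cases "x \<in> A")
      case True
      then show ?thesis using B[OF x] assms(3,4)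
        by (auto intro!: ennreal_leI young_mono[OF Y] divide_right_mono)
    next
      case False
      then show ?thesis using B[OF x] Y by (simp add: young_function_def)
    qed
  qed
  also have "\<dots> = ennreal (\<Phi> (B / r)) * emeasure M A"
    using assms(2) by (rule nn_integral_cmult_indicator)
  finally show ?thesis using small \<open>r > 0\<close> by (auto simp: modular_set_def)
qed

text \<open>Chebyshev's inequality for the modular: where |f| \<ge> \<open>s\<close>, the integrand
  is at least \<open>\<Phi> (s / r)\<close> by monotonicity.\<close>

lemma modular_chebyshev:
  assumes Y: "young_function \<Phi>" and [measurable]: "f \<in> borel_measurable M"
    and r: "r \<in> modular_set M \<Phi> f" and "s > 0"
  shows "ennreal (\<Phi> (s / r)) * emeasure M {x \<in> space M. s \<le> cmod (f x)} \<le> 1"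
proof -
  have "r > 0" using r by (simp add: modular_set_def)
  have "ennreal (\<Phi> (s / r)) * emeasure M {x \<in> space M. s \<le> cmod (f x)}
    = (\<integral>\<^sup>+ x. ennreal (\<Phi> (s / r)) * indicator {x \<in> space M. s \<le> cmod (f x)} x \<partial>M)"
    by (rule nn_integral_cmult_indicator[symmetric]) measurable
  also have "\<dots> \<le> (\<integral>\<^sup>+ x. ennreal (\<Phi> (cmod (f x) / r)) \<partial>M)"
    using \<open>s > 0\<close> \<open>r > 0\<close>
    by (intro nn_integral_mono)
      (auto simp: indicator_def intro!: ennreal_leI young_mono[OF Y] divide_right_mono)
  also have "\<dots> \<le> 1" using r by (simp add: modular_set_def)
  finally show ?thesis .
qed

text \<open>Since \<Phi> tends to infinity, some \<open>t > 0\<close> has \<open>\<Phi> t\<close>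
  \<ge> \<open>1 / \<eta>\<close>. Chebyshev with \<open>\<delta> = s / t\<close> gives the bound,
  uniformly in \<open>f\<close>.\<close>

lemma modular_small_imp_measure_small:
  assumes Y: "young_function \<Phi>" and "s > 0" "\<eta> > 0"
  obtains \<delta> where "\<delta> > 0"
    and "\<And>f. f \<in> borel_measurable M \<Longrightarrow> \<delta> \<in> modular_set M \<Phi> f \<Longrightarrow>
      emeasure M {x \<in> space M. s \<le> cmod (f x)} \<le> ennreal \<eta>"
proof -
  have "eventually (\<lambda>t. \<Phi> t \<ge> 1 / \<eta>) at_top"
    using Y by (auto simp: young_function_def filterlim_at_top)
  then obtain u where u: "\<And>t. t \<ge> u \<Longrightarrow> \<Phi> t \<ge> 1 / \<eta>"
    by (auto simp: eventually_at_top_linorder)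
  define t where "t = max u 1"
  have t: "t > 0" "\<Phi> t \<ge> 1 / \<eta>" using u by (auto simp: t_def)
  show thesis
  proof (rule that[of "s / t"])
    fix f :: "'a \<Rightarrow> complex"
    let ?E = "emeasure M {x \<in> space M. s \<le> cmod (f x)}"
    assume "f \<in> borel_measurable M" "s / t \<in> modular_set M \<Phi> f"
    then have "ennreal (\<Phi> t) * ?E \<le> 1"
      using modular_chebyshev[OF Y, of f M "s / t" s] \<open>s > 0\<close> t by simp
    moreover have "ennreal (1 / \<eta>) * ?E \<le> ennreal (\<Phi> t) * ?E"
      using t by (intro mult_right_mono ennreal_leI) auto
    ultimately have "ennreal (1 / \<eta>) * ?E \<le> 1" by (rule order_trans[rotated])
    then have "ennreal \<eta> * (ennreal (1 / \<eta>) * ?E) \<le> ennreal \<eta> * 1"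
      by (rule mult_left_mono) simp
    moreover have "ennreal \<eta> * ennreal (1 / \<eta>) = 1"
      using \<open>\<eta> > 0\<close> by (simp flip: ennreal_mult)
    ultimately show "?E \<le> ennreal \<eta>" by (simp flip: mult.assoc)
  qed (use t assms in auto)
qed

section \<open>Iterates of weighted translations\<close>

text \<open>This is the operator \<open>S\<close>, inverse to
  \<open>weighted_translation a w\<close> for positive \<open>w\<close>.\<close>

definition weighted_cotranslation ::
    "'g::group_add \<Rightarrow> ('g \<Rightarrow> real) \<Rightarrow> ('g \<Rightarrow> complex) \<Rightarrow> 'g \<Rightarrow> complex" where
  "weighted_cotranslation a w f = (\<lambda>x. f (x + a) / complex_of_real (w (x + a)))"

text \<open>Evaluating at the shifted point puts the weight product and \<open>f\<close> at the same
  \<open>x\<close>, so a bound on the product over the support of \<open>f\<close> can be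
  applied.\<close>

lemma translation_iter:
  "(weighted_translation a w ^^ m) f (x + gpow a m) = of_real (weight_prod a w m x) * f x"
proof (induction m)
  case (Suc m)
  have "x + gpow a (Suc m) - a = x + gpow a m"
    unfolding gpow_Suc_right by (metis add.assoc add_diff_cancel)
  then show ?case using Suc by (simp add: weighted_translation_def weight_prod_def)
qed (simp add: weight_prod_def)

text \<open>Each backward step divides by \<open>w\<close> at the point it leaves, so the factors
  start at \<open>x\<close> itself; this is why the tilde product runs from 0 to
  \<open>m - 1\<close>.\<close>

lemma cotranslation_iter:
  "(weighted_cotranslation a w ^^ m) f (x - gpow a m) = of_real (weight_prod_tilde a w m x) * f x"
proof (induction m)
  case (Suc m)
  have "x - gpow a (Suc m) + a = x - gpow a m"
    unfolding gpow_Suc by (simp add: diff_conv_add_uminus minus_add add.assoc del: add_uminus_conv_diff)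
  then show ?case using Suc by (simp add: weighted_cotranslation_def weight_prod_tilde_def divide_simps)
qed (simp add: weight_prod_tilde_def)

lemma translation_cotranslation:
  assumes "\<And>x. w x > 0"
  shows "weighted_translation a w (weighted_cotranslation a w f) = f"
    and "weighted_cotranslation a w (weighted_translation a w f) = f"
proof -
  have "w x \<noteq> 0" for x using assms[of x] by simp
  then show "weighted_translation a w (weighted_cotranslation a w f) = f"
    and "weighted_cotranslation a w (weighted_translation a w f) = f"
    by (auto simp: fun_eq_iff weighted_translation_def weighted_cotranslation_def)
qed

lemma funpow_left_inverse:
  fixes f g :: "'a \<Rightarrow> 'a"
  assumes "\<And>x. f (g x) = x"
  shows "(f ^^ n) ((g ^^ n) x) = x"
proof (induction n)
  case (Suc n)
  have "(f ^^ Suc n) ((g ^^ Suc n) x) = (f ^^ n) (f (g ((g ^^ n) x)))"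
    by (simp add: funpow_swap1)
  then show ?case using Suc assms by simp
qed simp

lemma funpow_left_inverse_diff:
  fixes f g :: "'a \<Rightarrow> 'a"
  assumes "\<And>x. f (g x) = x"
  shows "(f ^^ m) ((g ^^ n) x) = (if m \<le> n then (g ^^ (n - m)) x else (f ^^ (m - n)) x)"
proof (cases "m \<le> n")
  case True
  have "(g ^^ n) x = (g ^^ m) ((g ^^ (n - m)) x)"
    using True by (metis comp_apply funpow_add le_add_diff_inverse)
  then show ?thesis using True by (simp add: funpow_left_inverse[of f g, OF assms])
next
  case False
  have "(f ^^ m) ((g ^^ n) x) = (f ^^ (m - n)) ((f ^^ n) ((g ^^ n) x))"
    using False by (metis comp_apply funpow_add le_add_diff_inverse2 linorder_le_cases)
  then show ?thesis using False by (simp add: funpow_left_inverse[of f g, OF assms])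
qed

lemma translation_iter_sum:
  "(weighted_translation a w ^^ m) (\<lambda>x. \<Sum>i\<in>I. f i x) =
    (\<lambda>x. \<Sum>i\<in>I. (weighted_translation a w ^^ m) (f i) x)"
  by (induction m) (auto simp: weighted_translation_def sum_distrib_left)

section \<open>Invariance under right translations\<close>

locale right_haar =
  fixes lam :: "'g::{topological_group_add, t2_space, second_countable_topology} measure"
  assumes haar: "right_haar_measure lam"
begin

section \<open>Borel sets and invariance of integrals\<close>

lemma sets_lam [measurable_cong]: "sets lam = sets borel"
  using haar by (simp add: right_haar_measure_def)

lemma space_lam [simp]: "space lam = UNIV"
  using sets_eq_imp_space_eq[OF sets_lam] by simp

lemma continuous_measurable:
  assumes "continuous_on UNIV f"
  shows "f \<in> borel_measurable lam"
  using borel_measurable_continuous_onI[OF assms] measurable_cong_sets[OF sets_lam refl] by blast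

lemma compact_measurable: "compact K \<Longrightarrow> K \<in> sets lam"
  by (simp add: sets_lam compact_imp_closed borel_closed)

lemma emeasure_compact: "compact K \<Longrightarrow> emeasure lam K < \<infinity>"
  using haar by (simp add: right_haar_measure_def)

lemma shift_measurable [measurable]: "(\<lambda>x. x + g) \<in> measurable lam lam"
proof -
  have "(\<lambda>x. x + g) \<in> borel_measurable borel"
    by (intro borel_measurable_continuous_onI continuous_intros)
  then show ?thesis using measurable_cong_sets[OF sets_lam sets_lam] by blast
qed

lemma shift_diff_measurable [measurable]: "(\<lambda>x. x - g) \<in> measurable lam lam"
  using shift_measurable[of "- g"] by simp

lemma distr_shift: "distr lam lam (\<lambda>x. x + g) = lam"
proof (rule measure_eqI)
  fix A assume "A \<in> sets (distr lam lam (\<lambda>x. x + g))"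
  then have A: "A \<in> sets borel" by (simp add: sets_lam)
  have "(\<lambda>x. x + g) -` A = (\<lambda>x. x + - g) ` A"
    by (auto simp: image_iff) (metis add_diff_cancel)
  then show "emeasure (distr lam lam (\<lambda>x. x + g)) A = emeasure lam A"
    using A haar by (simp add: emeasure_distr sets_lam right_haar_measure_def del: add_uminus_conv_diff)
qed simp

lemma nn_integral_shift:
  assumes "h \<in> borel_measurable lam"
  shows "(\<integral>\<^sup>+ x. h (x + g) \<partial>lam) = (\<integral>\<^sup>+ x. h x \<partial>lam)"
  using nn_integral_distr[OF shift_measurable, of h g] assms by (simp add: distr_shift)

lemma emeasure_shift:
  assumes "{x. P x} \<in> sets lam"
  shows "emeasure lam {x. P (x + g)} = emeasure lam {x. P x}"
proof -
  have "emeasure (distr lam lam (\<lambda>x. x + g)) {x. P x} = emeasure lam {x. P (x + g)}"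
    using assms by (simp add: emeasure_distr vimage_def)
  then show ?thesis by (simp add: distr_shift)
qed

lemma modular_set_shift:
  assumes Y: "young_function \<Phi>" and [measurable]: "f \<in> borel_measurable lam"
  shows "k \<in> modular_set lam \<Phi> (\<lambda>x. f (x + g)) \<longleftrightarrow> k \<in> modular_set lam \<Phi> f"
proof -
  note [measurable] = young_measurable[OF Y]
  have "(\<integral>\<^sup>+ x. ennreal (\<Phi> (cmod (f (x + g)) / k)) \<partial>lam) = (\<integral>\<^sup>+ x. ennreal (\<Phi> (cmod (f x) / k)) \<partial>lam)"
    by (rule nn_integral_shift[where h = "\<lambda>x. ennreal (\<Phi> (cmod (f x) / k))"]) measurable
  then show ?thesis by (simp add: modular_set_def)
qed

section \<open>Weight products and iterates on functions\<close>

lemma weight_measurable: "weight w \<Longrightarrow> w \<in> borel_measurable lam"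
  by (intro continuous_measurable) (simp add: weight_def)

lemma weight_prod_measurable:
  assumes "weight w"
  shows "weight_prod a w n \<in> borel_measurable lam"
proof -
  note [measurable] = weight_measurable[OF assms]
  show ?thesis unfolding weight_prod_def by measurable
qed

lemma weight_prod_tilde_measurable:
  assumes "weight w"
  shows "weight_prod_tilde a w n \<in> borel_measurable lam"
proof -
  note [measurable] = weight_measurable[OF assms]
  show ?thesis unfolding weight_prod_tilde_def by measurable
qed

lemma translation_iter_measurable:
  assumes "weight w" "f \<in> borel_measurable lam"
  shows "(weighted_translation a w ^^ m) f \<in> borel_measurable lam"
proof (induction m)
  case (Suc m)
  note [measurable] = weight_measurable[OF assms(1)] Suc
  let ?g = "(weighted_translation a w ^^ m) f"
  have "(\<lambda>x. complex_of_real (w x) * ?g (x - a)) \<in> borel_measurable lam" by measurable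
  then show ?case by (simp add: weighted_translation_def[of a w ?g])
qed (simp add: assms)

lemma cotranslation_iter_measurable:
  assumes "weight w" "f \<in> borel_measurable lam"
  shows "(weighted_cotranslation a w ^^ m) f \<in> borel_measurable lam"
proof (induction m)
  case (Suc m)
  note [measurable] = weight_measurable[OF assms(1)] Suc
  let ?g = "(weighted_cotranslation a w ^^ m) f"
  have "(\<lambda>x. ?g (x + a) / complex_of_real (w (x + a))) \<in> borel_measurable lam" by measurable
  then show ?case by (simp add: weighted_cotranslation_def[of a w ?g])
qed (simp add: assms)

lemma weight_prod_pos: "weight w \<Longrightarrow> weight_prod a w n x > 0"
  by (auto simp: weight_prod_def weight_def intro!: prod_pos)

lemma weight_prod_tilde_pos: "weight w \<Longrightarrow> weight_prod_tilde a w n x > 0"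
  by (auto simp: weight_prod_tilde_def weight_def intro!: prod_pos)

text \<open>Right invariance lets the iterate be replaced by its translate, which is
  \<open>weight_prod a w m\<close> times \<open>f\<close> and so at most \<open>c\<close> times |f|
  almost everywhere.\<close>

lemma modular_translation_iter:
  assumes Y: "young_function \<Phi>" and w: "weight w" and f: "f \<in> borel_measurable lam"
    and k: "k \<in> modular_set lam \<Phi> f" and "c > 0"
    and small: "AE x in lam. f x \<noteq> 0 \<longrightarrow> weight_prod a w m x \<le> c"
  shows "c * k \<in> modular_set lam \<Phi> ((weighted_translation a w ^^ m) f)"
proof -
  have "c * k \<in> modular_set lam \<Phi> (\<lambda>x. of_real (weight_prod a w m x) * f x)"
  proof (rule modular_set_scale[OF Y k \<open>c > 0\<close>], use small in eventually_elim)
    fix x assume "f x \<noteq> 0 \<longrightarrow> weight_prod a w m x \<le> c"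
    then show "cmod (of_real (weight_prod a w m x) * f x) \<le> c * cmod (f x)"
      using weight_prod_pos[OF w, of a m x] by (cases "f x = 0") (auto simp: norm_mult)
  qed
  then show ?thesis
    unfolding translation_iter[symmetric]
    by (subst (asm) modular_set_shift[OF Y translation_iter_measurable[OF w f]])
qed

lemma modular_cotranslation_iter:
  assumes Y: "young_function \<Phi>" and w: "weight w" and f: "f \<in> borel_measurable lam"
    and k: "k \<in> modular_set lam \<Phi> f" and "c > 0"
    and small: "AE x in lam. f x \<noteq> 0 \<longrightarrow> weight_prod_tilde a w m x \<le> c"
  shows "c * k \<in> modular_set lam \<Phi> ((weighted_cotranslation a w ^^ m) f)"
proof -
  have "c * k \<in> modular_set lam \<Phi> (\<lambda>x. of_real (weight_prod_tilde a w m x) * f x)"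
  proof (rule modular_set_scale[OF Y k \<open>c > 0\<close>], use small in eventually_elim)
    fix x assume "f x \<noteq> 0 \<longrightarrow> weight_prod_tilde a w m x \<le> c"
    then show "cmod (of_real (weight_prod_tilde a w m x) * f x) \<le> c * cmod (f x)"
      using weight_prod_tilde_pos[OF w, of a m x] by (cases "f x = 0") (auto simp: norm_mult)
  qed
  then have "c * k \<in> modular_set lam \<Phi> (\<lambda>x. (weighted_cotranslation a w ^^ m) f (x + - gpow a m))"
    by (simp add: cotranslation_iter)
  then show ?thesis
    by (subst (asm) modular_set_shift[OF Y cotranslation_iter_measurable[OF w f]])
qed

text \<open>Both claims go through one induction, because applying the operator to a class needs its
  representative to lie in \<open>orlicz_fun\<close>.\<close>

lemma orlicz_translation_iter:
  assumes Y: "young_function \<Phi>" and w: "weight w" and f: "f \<in> orlicz_fun lam \<Phi>"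
  shows "(weighted_translation a w ^^ m) f \<in> orlicz_fun lam \<Phi> \<and>
    (orlicz_translation lam \<Phi> a w ^^ m) (orlicz_rel lam \<Phi> `` {f}) =
      orlicz_rel lam \<Phi> `` {(weighted_translation a w ^^ m) f}"
proof (induction m)
  case (Suc m)
  then show ?case using orlicz_translation_class[OF haar w Y] by simp
qed (simp add: f)

section \<open>Density of bounded functions with compact support\<close>

text \<open>Finiteness holds for one factor \<alpha>, and \<Delta>2-regularity preserves it under
  doubling; enough doublings pass |c|.\<close>

lemma delta2_modular_finite:
  assumes Y: "young_function \<Phi>" and D: "delta2_regular TYPE('g) \<Phi>" and f: "f \<in> orlicz_fun lam \<Phi>"
  shows "(\<integral>\<^sup>+ x. ennreal (\<Phi> (c * cmod (f x))) \<partial>lam) < \<infinity>"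
proof -
  note [measurable] = young_measurable[OF Y]
  obtain \<alpha> where [measurable]: "f \<in> borel_measurable lam" and "\<alpha> > 0"
    and fin: "(\<integral>\<^sup>+ x. ennreal (\<Phi> (\<alpha> * cmod (f x))) \<partial>lam) < \<infinity>"
    using f by (auto simp: orlicz_fun_def)
  \<comment> \<open>Both forms of regularity become one inequality with an error \<open>d\<close>.
    For compact \<open>G\<close>, \<open>d = \<Phi> (2 * t0)\<close> covers the small arguments and
    the total mass is finite; otherwise \<open>d = 0\<close>, and the product with the mass is 0
    even if the mass is infinite.\<close>
  obtain M d where M: "M > 0" "d \<ge> 0" and d: "ennreal d * emeasure lam UNIV < \<infinity>"
    and le: "\<And>t. t \<ge> 0 \<Longrightarrow> \<Phi> (2 * t) \<le> M * \<Phi> t + d"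
  proof (cases "compact (UNIV :: 'g set)")
    case True
    then obtain M t0 where Mt: "M > 0" "t0 > 0" "\<And>t. t \<ge> t0 \<Longrightarrow> \<Phi> (2 * t) \<le> M * \<Phi> t"
      using D by (auto simp: delta2_regular_def)
    have "\<Phi> (2 * t) \<le> M * \<Phi> t + \<Phi> (2 * t0)" if "t \<ge> 0" for t
    proof (cases "t \<ge> t0")
      case True
      then show ?thesis using Mt(3)[of t] young_nonneg[OF Y, of "2 * t0"] by simp
    next
      case False
      then show ?thesis using young_mono[OF Y, of "2 * t" "2 * t0"] that Mt young_nonneg[OF Y, of t]
        by (simp add: add_increasing)
    qed
    then show thesis
      using that[of M "\<Phi> (2 * t0)"] Mt young_nonneg[OF Y] emeasure_compact[OF True]
      by (simp add: ennreal_mult_less_top)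
  next
    case False
    then obtain M where "M > 0" "\<And>t. t > 0 \<Longrightarrow> \<Phi> (2 * t) \<le> M * \<Phi> t"
      using D by (auto simp: delta2_regular_def)
    moreover have "\<Phi> 0 = 0" using Y by (simp add: young_function_def)
    ultimately show thesis using that[of M 0] by (force simp: le_less)
  qed
  have pow: "(\<integral>\<^sup>+ x. ennreal (\<Phi> (2 ^ m * (\<alpha> * cmod (f x)))) \<partial>lam) < \<infinity>" for m
  proof (induction m)
    case (Suc m)
    have "(\<integral>\<^sup>+ x. ennreal (\<Phi> (2 ^ Suc m * (\<alpha> * cmod (f x)))) \<partial>lam)
      \<le> (\<integral>\<^sup>+ x. ennreal M * ennreal (\<Phi> (2 ^ m * (\<alpha> * cmod (f x)))) + ennreal d \<partial>lam)"
    proof (rule nn_integral_mono)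
      fix x
      have "\<Phi> (2 * (2 ^ m * (\<alpha> * cmod (f x)))) \<le> M * \<Phi> (2 ^ m * (\<alpha> * cmod (f x))) + d"
        using \<open>\<alpha> > 0\<close> by (intro le) auto
      then show "ennreal (\<Phi> (2 ^ Suc m * (\<alpha> * cmod (f x))))
          \<le> ennreal M * ennreal (\<Phi> (2 ^ m * (\<alpha> * cmod (f x)))) + ennreal d"
        using M young_nonneg[OF Y]
        by (simp add: ennreal_mult[symmetric] ennreal_plus[symmetric] ennreal_leI mult.assoc del: ennreal_plus)
    qed
    also have "\<dots> = ennreal M * (\<integral>\<^sup>+ x. ennreal (\<Phi> (2 ^ m * (\<alpha> * cmod (f x)))) \<partial>lam)
        + ennreal d * emeasure lam UNIV"
      by (subst nn_integral_add) (auto simp: nn_integral_cmult)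
    also have "\<dots> < \<infinity>" using Suc d by (simp add: ennreal_mult_less_top)
    finally show ?case .
  qed (simp add: fin[simplified])
  obtain m where m: "\<bar>c\<bar> / \<alpha> < 2 ^ m" using real_arch_pow[of 2] by force
  have even: "\<Phi> (c * s) = \<Phi> (\<bar>c\<bar> * s)" for s
    using Y by (cases "c \<ge> 0") (auto simp: young_function_def)
  have "(\<integral>\<^sup>+ x. ennreal (\<Phi> (c * cmod (f x))) \<partial>lam) \<le> (\<integral>\<^sup>+ x. ennreal (\<Phi> (2 ^ m * (\<alpha> * cmod (f x)))) \<partial>lam)"
    unfolding even
  proof (intro nn_integral_mono ennreal_leI young_mono[OF Y])
    fix x
    have "\<bar>c\<bar> * cmod (f x) \<le> (2 ^ m * \<alpha>) * cmod (f x)"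
      using m \<open>\<alpha> > 0\<close> by (intro mult_right_mono) (auto simp: field_simps)
    then show "\<bar>c\<bar> * cmod (f x) \<le> 2 ^ m * (\<alpha> * cmod (f x))" by (simp add: mult.assoc)
  qed simp
  then show ?thesis using pow by (rule order.strict_trans1)
qed

text \<open>By Lindelof, countably many open sets with compact supersets cover the group; finite
  unions of these supersets give the exhaustion.\<close>

lemma compact_exhaustion:
  assumes "locally_compact_space (euclidean :: 'g topology)"
  obtains K :: "nat \<Rightarrow> 'g set" where "\<And>i. compact (K i)" "incseq K" "\<Union>(range K) = UNIV"
proof -
  have "\<exists>U C. open U \<and> compact C \<and> x \<in> U \<and> U \<subseteq> C" for x :: 'g
    using assms by (simp add: locally_compact_space_def)
  then obtain U C :: "'g \<Rightarrow> 'g set"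
    where UC: "\<And>x. open (U x)" "\<And>x. compact (C x)" "\<And>x. x \<in> U x" "\<And>x. U x \<subseteq> C x"
    by metis
  obtain F where F: "F \<subseteq> range U" "countable F" "\<Union>F = \<Union>(range U)"
    using Lindelof[of "range U"] UC(1) by blast
  obtain A where A: "countable A" "F = U ` A"
    using F countable_subset_image by metis
  have "\<Union>(U ` A) = \<Union>(range U)" using F(3) A(2) by simp
  also have "\<dots> = UNIV" by (rule UNIV_eq_I[symmetric]) (rule UN_I, rule UNIV_I, rule UC(3))
  finally have cov: "\<Union>(U ` A) = UNIV" .
  then have "A \<noteq> {}" by auto
  \<comment> \<open>\<open>from_nat_into A\<close> enumerates the nonempty countable set
    \<open>A\<close>, with repetitions if \<open>A\<close> is finite.\<close>
  define K where "K i = (\<Union>j\<le>i. C (from_nat_into A j))" for i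
  show thesis
  proof
    show "compact (K i)" for i unfolding K_def by (intro compact_UN UC) auto
    show "incseq K" unfolding K_def by (intro incseq_SucI) (force simp: atMost_Suc)
    show "\<Union>(range K) = UNIV"
    proof safe
      fix x :: 'g
      obtain y where "y \<in> A" "x \<in> U y" using cov by blast
      moreover obtain j where "y = from_nat_into A j"
        using \<open>y \<in> A\<close> A(1) from_nat_into_surj by metis
      ultimately have "x \<in> K j" using UC(4) by (auto simp: K_def)
      then show "x \<in> \<Union>(range K)" by blast
    qed simp
  qed
qed

text \<open>Truncate \<open>f\<close> both in space and in size. The error is dominated by |f|,
  whose modular at scale \<open>1 / r\<close> is finite by \<Delta>2-regularity, so dominated
  convergence brings the modular of the error below 1.\<close>

lemma bounded_compact_support_dense:
  assumes lc: "locally_compact_space (euclidean :: 'g topology)" and Y: "young_function \<Phi>"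
    and D: "delta2_regular TYPE('g) \<Phi>" and f: "f \<in> orlicz_fun lam \<Phi>" and "r > 0"
  obtains K B g where "compact K" "B \<ge> 0" "g \<in> borel_measurable lam"
    "\<And>x. cmod (g x) \<le> B * indicator K x" "r \<in> modular_set lam \<Phi> (\<lambda>x. f x - g x)"
proof -
  note [measurable] = young_measurable[OF Y]
  have [measurable]: "f \<in> borel_measurable lam" using f by (simp add: orlicz_fun_def)
  have \<Phi>0: "\<Phi> 0 = 0" using Y by (simp add: young_function_def)
  obtain K :: "nat \<Rightarrow> 'g set" where K: "\<And>i. compact (K i)" "incseq K" "\<Union>(range K) = UNIV"
    using compact_exhaustion[OF lc] by metis
  have [measurable]: "K i \<in> sets lam" for i using K(1) by (rule compact_measurable)
  define g where "g i x = (if x \<in> K i \<and> cmod (f x) \<le> real i then f x else 0)" for i x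
  have [measurable]: "g i \<in> borel_measurable lam" for i unfolding g_def by measurable
  have ev: "eventually (\<lambda>i. g i x = f x) sequentially" for x
  proof -
    obtain i where i: "x \<in> K i" using K(3) by blast
    obtain j where j: "cmod (f x) \<le> real j" using real_arch_simple by blast
    have "g n x = f x" if "n \<ge> max i j" for n
      using that i j incseqD[OF K(2), of i n] by (auto simp: g_def)
    then show ?thesis unfolding eventually_sequentially by blast
  qed
  have "(\<lambda>i. \<integral>\<^sup>+ x. ennreal (\<Phi> (cmod (f x - g i x) / r)) \<partial>lam) \<longlonglongrightarrow> (\<integral>\<^sup>+ x. 0 \<partial>lam)"
  proof (rule nn_integral_dominated_convergence[where w = "\<lambda>x. ennreal (\<Phi> (1 / r * cmod (f x)))"])
    show "AE x in lam. ennreal (\<Phi> (cmod (f x - g i x) / r)) \<le> ennreal (\<Phi> (1 / r * cmod (f x)))" for i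
      using \<open>r > 0\<close>
      by (intro AE_I2 ennreal_leI young_mono[OF Y]) (auto simp: g_def)
    show "AE x in lam. (\<lambda>i. ennreal (\<Phi> (cmod (f x - g i x) / r))) \<longlonglongrightarrow> 0"
    proof (intro AE_I2 tendsto_eventually)
      show "eventually (\<lambda>i. ennreal (\<Phi> (cmod (f x - g i x) / r)) = 0) sequentially" for x
        using ev[of x] by eventually_elim (simp add: \<Phi>0)
    qed
  qed (use delta2_modular_finite[OF Y D f, of "1 / r"] in \<open>auto\<close>)
  then have "eventually (\<lambda>i. (\<integral>\<^sup>+ x. ennreal (\<Phi> (cmod (f x - g i x) / r)) \<partial>lam) < 1) sequentially"
    by (intro order_tendstoD) auto
  then obtain i where "(\<integral>\<^sup>+ x. ennreal (\<Phi> (cmod (f x - g i x) / r)) \<partial>lam) < 1"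
    by (auto simp: eventually_sequentially)
  then show thesis
    using K(1) \<open>r > 0\<close> by (intro that[of "K i" "real i" "g i"]) (auto simp: modular_set_def g_def)
qed

section \<open>From decaying weights to multiple recurrence\<close>

lemma orlicz_fun_of_bounded:
  assumes Y: "young_function \<Phi>" and [measurable]: "f \<in> borel_measurable lam" and K: "compact K"
    and B: "\<And>x. cmod (f x) \<le> B * indicator K x"
  shows "f \<in> orlicz_fun lam \<Phi>"
proof -
  have "(\<integral>\<^sup>+ x. ennreal (\<Phi> (1 * cmod (f x))) \<partial>lam) \<le> (\<integral>\<^sup>+ x. ennreal (\<Phi> B) * indicator K x \<partial>lam)"
  proof (rule nn_integral_mono)
    show "ennreal (\<Phi> (1 * cmod (f x))) \<le> ennreal (\<Phi> B) * indicator K x" for x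
      using B[of x] Y young_mono[OF Y, of "cmod (f x)" B]
      by (auto simp: indicator_def young_function_def intro!: ennreal_leI split: if_splits)
  qed
  also have "\<dots> = ennreal (\<Phi> B) * emeasure lam K"
    using compact_measurable[OF K] by (rule nn_integral_cmult_indicator)
  also have "\<dots> < \<infinity>" using emeasure_compact[OF K] by (simp add: ennreal_mult_less_top)
  finally show ?thesis unfolding orlicz_fun_def by (auto intro!: exI[of _ "1 :: real"])
qed

lemma Linf_norm_restrict_AE:
  assumes "E \<in> sets lam" "Linf_norm (restrict_space lam E) c < ennreal \<epsilon>"
  shows "AE x in lam. x \<in> E \<longrightarrow> c x \<le> \<epsilon>"
proof -
  have "AE x in restrict_space lam E. ennreal \<bar>c x\<bar> \<le> Linf_norm (restrict_space lam E) c"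
    unfolding Linf_norm_def by (rule esssup_AE)
  then have "AE x in restrict_space lam E. c x \<le> \<epsilon>"
  proof eventually_elim
    case (elim x)
    then have "ennreal \<bar>c x\<bar> < ennreal \<epsilon>" using assms(2) by (rule order.strict_trans1)
    then have "\<bar>c x\<bar> < \<epsilon>" by (simp add: ennreal_less_iff)
    then show ?case by simp
  qed
  then show ?thesis using assms(1) by (simp add: AE_restrict_space_iff)
qed

text \<open>With \<open>g = f \<cdot> 1\<^bsub>E\<^esub>\<close> and \<open>S\<close> the inverse of \<open>T\<close>, the witness is \<open>v = \<Sum>m\<le>L. S\<^sup>m\<^sup>n g\<close>: the term
  \<open>m = l\<close> of \<open>T\<^sup>l\<^sup>n v\<close> is \<open>g\<close>, and the others are small.\<close>

lemma recurrence_near_bounded: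
  assumes Y: "young_function \<Phi>" and w: "weight w" and f: "f \<in> borel_measurable lam"
    and K: "compact K" and B: "B \<ge> 0" "\<And>x. cmod (f x) \<le> B * indicator K x" and "r > 0"
    and E: "\<forall>k. E k \<in> sets borel \<and> E k \<subseteq> K"
    and lim: "(\<lambda>k. emeasure lam (E k)) \<longlonglongrightarrow> emeasure lam K"
    and decay: "\<forall>l\<in>{1..L}.
        (\<lambda>k. Linf_norm (restrict_space lam (E k)) (weight_prod a w (l * n k))) \<longlonglongrightarrow> 0 \<and>
        (\<lambda>k. Linf_norm (restrict_space lam (E k)) (weight_prod_tilde a w (l * n k))) \<longlonglongrightarrow> 0"
  shows "\<exists>k. \<exists>v\<in>orlicz_fun lam \<Phi>. \<forall>l\<le>L.
    r \<in> modular_set lam \<Phi> (\<lambda>x. (weighted_translation a w ^^ (l * n k)) v x - f x)"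
proof -
  have EK: "E k \<subseteq> K" for k using E by blast
  have Em: "E k \<in> sets lam" for k using E by (simp add: sets_lam)
  have Km: "K \<in> sets lam" using K by (rule compact_measurable)
  have fo: "f \<in> orlicz_fun lam \<Phi>" using orlicz_fun_of_bounded[OF Y f K B(2)] .
  then obtain \<kappa> where \<kappa>: "\<kappa> \<in> modular_set lam \<Phi> f" using modular_set_nonempty[OF Y] by blast
  then have "\<kappa> > 0" by (simp add: modular_set_def)
  \<comment> \<open>Half of \<open>r\<close> is for replacing \<open>f\<close> by \<open>g\<close>;
    the other half is shared by the \<open>L\<close> unwanted terms, each of size
    \<open>\<epsilon> * \<kappa>\<close>.\<close>
  define \<epsilon> where "\<epsilon> = r / (2 * (real L + 1) * \<kappa>)"
  have "\<epsilon> > 0" using \<open>r > 0\<close> \<open>\<kappa> > 0\<close> by (simp add: \<epsilon>_def)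
  have total: "real L * (\<epsilon> * \<kappa>) \<le> r / 2"
  proof -
    have eq: "\<epsilon> * \<kappa> = r / (2 * (real L + 1))" using \<open>\<kappa> > 0\<close> by (simp add: \<epsilon>_def)
    show ?thesis unfolding eq using \<open>r > 0\<close> by (simp add: field_simps)
  qed
  have Kfin: "emeasure lam K \<noteq> \<infinity>" using emeasure_compact[OF K] by simp
  have "emeasure lam (E k) \<noteq> \<infinity>" for k
    using emeasure_mono[OF EK[of k] Km] Kfin by (auto simp: top_unique)
  then have Diff: "emeasure lam (K - E k) = emeasure lam K - emeasure lam (E k)" for k
    by (intro emeasure_Diff Em Km EK)
  have "(\<lambda>k. emeasure lam K - emeasure lam (E k)) \<longlonglongrightarrow> emeasure lam K - emeasure lam K"
    using Kfin by (intro tendsto_diff_ennreal lim tendsto_const) auto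
  then have "(\<lambda>k. emeasure lam (K - E k)) \<longlonglongrightarrow> 0"
    unfolding Diff using Kfin by simp
  then have "(\<lambda>k. ennreal (\<Phi> (B / (r / 2))) * emeasure lam (K - E k)) \<longlonglongrightarrow> ennreal (\<Phi> (B / (r / 2))) * 0"
    by (intro ennreal_tendsto_cmult) auto
  \<comment> \<open>This is the smallness condition under which cutting \<open>f\<close> down to
    \<open>E k\<close> costs at most \<open>r / 2\<close>: the difference is bounded by
    \<open>B\<close> and lives on \<open>K - E k\<close>.\<close>
  then have "eventually (\<lambda>k. ennreal (\<Phi> (B / (r / 2))) * emeasure lam (K - E k) < 1) sequentially"
    by (intro order_tendstoD(2)) auto
  moreover have "eventually (\<lambda>k. \<forall>l\<in>{1..L}.
      Linf_norm (restrict_space lam (E k)) (weight_prod a w (l * n k)) < ennreal \<epsilon> \<and>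
      Linf_norm (restrict_space lam (E k)) (weight_prod_tilde a w (l * n k)) < ennreal \<epsilon>) sequentially"
  proof (rule eventually_ball_finite[OF finite_atLeastAtMost], rule ballI)
    fix l assume l: "l \<in> {1..L}"
    have "0 < ennreal \<epsilon>" using \<open>\<epsilon> > 0\<close> by simp
    then show "eventually (\<lambda>k.
        Linf_norm (restrict_space lam (E k)) (weight_prod a w (l * n k)) < ennreal \<epsilon> \<and>
        Linf_norm (restrict_space lam (E k)) (weight_prod_tilde a w (l * n k)) < ennreal \<epsilon>) sequentially"
      using order_tendstoD(2)[OF conjunct1[OF bspec[OF decay l]]]
        order_tendstoD(2)[OF conjunct2[OF bspec[OF decay l]]]
      by (simp add: eventually_conj)
  qed
  ultimately have "eventually (\<lambda>k. ennreal (\<Phi> (B / (r / 2))) * emeasure lam (K - E k) < 1 \<and>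
    (\<forall>l\<in>{1..L}. Linf_norm (restrict_space lam (E k)) (weight_prod a w (l * n k)) < ennreal \<epsilon> \<and>
      Linf_norm (restrict_space lam (E k)) (weight_prod_tilde a w (l * n k)) < ennreal \<epsilon>)) sequentially"
    by (rule eventually_conj)
  then obtain k where k: "ennreal (\<Phi> (B / (r / 2))) * emeasure lam (K - E k) < 1"
    "\<And>l. l \<in> {1..L} \<Longrightarrow> Linf_norm (restrict_space lam (E k)) (weight_prod a w (l * n k)) < ennreal \<epsilon>"
    "\<And>l. l \<in> {1..L} \<Longrightarrow> Linf_norm (restrict_space lam (E k)) (weight_prod_tilde a w (l * n k)) < ennreal \<epsilon>"
    by (auto simp: eventually_sequentially)
  define g where "g x = f x * indicator (E k) x" for x
  have g: "g \<in> borel_measurable lam" unfolding g_def using f Em by measurable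
  have "1 * \<kappa> \<in> modular_set lam \<Phi> g"
    by (rule modular_set_scale[OF Y \<kappa>]) (auto simp: g_def indicator_def)
  then have g\<kappa>: "\<kappa> \<in> modular_set lam \<Phi> g" by simp
  have gf: "r / 2 \<in> modular_set lam \<Phi> (\<lambda>x. g x - f x)"
  proof (rule modular_set_of_bounded[OF Y])
    show "cmod (g x - f x) \<le> B * indicator (K - E k) x" for x
      using B(2)[of x] by (auto simp: g_def indicator_def split: if_splits)
  qed (use Em Km \<open>r > 0\<close> B(1) k(1) in auto)
  have T: "\<epsilon> * \<kappa> \<in> modular_set lam \<Phi> ((weighted_translation a w ^^ (j * n k)) g)"
    and S: "\<epsilon> * \<kappa> \<in> modular_set lam \<Phi> ((weighted_cotranslation a w ^^ (j * n k)) g)"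
    if "j \<in> {1..L}" for j
  proof -
    have "AE x in lam. g x \<noteq> 0 \<longrightarrow> weight_prod a w (j * n k) x \<le> \<epsilon>"
      using Linf_norm_restrict_AE[OF Em k(2)[OF that]] by eventually_elim (auto simp: g_def)
    then show "\<epsilon> * \<kappa> \<in> modular_set lam \<Phi> ((weighted_translation a w ^^ (j * n k)) g)"
      by (rule modular_translation_iter[OF Y w g g\<kappa> \<open>\<epsilon> > 0\<close>])
    have "AE x in lam. g x \<noteq> 0 \<longrightarrow> weight_prod_tilde a w (j * n k) x \<le> \<epsilon>"
      using Linf_norm_restrict_AE[OF Em k(3)[OF that]] by eventually_elim (auto simp: g_def)
    then show "\<epsilon> * \<kappa> \<in> modular_set lam \<Phi> ((weighted_cotranslation a w ^^ (j * n k)) g)"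
      by (rule modular_cotranslation_iter[OF Y w g g\<kappa> \<open>\<epsilon> > 0\<close>])
  qed
  define v where "v x = (\<Sum>m\<le>L. (weighted_cotranslation a w ^^ (m * n k)) g x)" for x
  have vm: "v \<in> borel_measurable lam"
    unfolding v_def by (intro borel_measurable_sum cotranslation_iter_measurable w g)
  have close: "r \<in> modular_set lam \<Phi> (\<lambda>x. (weighted_translation a w ^^ (l * n k)) v x - f x)"
    if l: "l \<le> L" for l
  proof -
    define h where
      "h m = (weighted_translation a w ^^ (l * n k)) ((weighted_cotranslation a w ^^ (m * n k)) g)" for m
    have h: "h m = (if l \<le> m then (weighted_cotranslation a w ^^ ((m - l) * n k)) g
        else (weighted_translation a w ^^ ((l - m) * n k)) g)" for m
    proof -
      have "w x > 0" for x using w by (simp add: weight_def)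
      note inv = translation_cotranslation(1)[of w a, OF this]
      \<comment> \<open>For \<open>n k = 0\<close> all iterates are the identity; otherwise
        comparing \<open>l * n k\<close> with \<open>m * n k\<close> amounts to comparing
        \<open>l\<close> with \<open>m\<close>.\<close>
      show ?thesis unfolding h_def
        using funpow_left_inverse_diff[of "weighted_translation a w" "weighted_cotranslation a w"
            "l * n k" "m * n k" g, OF inv]
        by (cases "n k = 0") (auto simp: diff_mult_distrib)
    qed
    have "(weighted_translation a w ^^ (l * n k)) v x = (\<Sum>m\<le>L. h m x)" for x
      unfolding h_def v_def[abs_def] by (rule fun_cong[OF translation_iter_sum])
    also have "(\<Sum>m\<le>L. h m x) = g x + (\<Sum>m\<in>{..L} - {l}. h m x)" for x
      using l by (subst sum.remove[of _ l]) (auto simp: h)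
    finally have eq: "(weighted_translation a w ^^ (l * n k)) v x - f x
        = (g x - f x) + (\<Sum>m\<in>{..L} - {l}. h m x)" for x by simp
    have "r / 2 + (\<Sum>m\<in>{..L} - {l}. \<epsilon> * \<kappa>) \<in> modular_set lam \<Phi> (\<lambda>x. (g x - f x) + (\<Sum>m\<in>{..L} - {l}. h m x))"
    proof (rule modular_set_add_sum[OF Y _ gf])
      show "\<epsilon> * \<kappa> \<in> modular_set lam \<Phi> (h m)" if "m \<in> {..L} - {l}" for m
        using that l by (auto simp: h intro!: S T)
      show "h m \<in> borel_measurable lam" for m
        unfolding h_def by (intro translation_iter_measurable cotranslation_iter_measurable w g)
    qed (use f g in auto)
    moreover have "(\<Sum>m\<in>{..L} - {l}. \<epsilon> * \<kappa>) = real L * (\<epsilon> * \<kappa>)" using l by simp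
    ultimately have "r / 2 + real L * (\<epsilon> * \<kappa>)
        \<in> modular_set lam \<Phi> (\<lambda>x. (g x - f x) + (\<Sum>m\<in>{..L} - {l}. h m x))" by (simp only:)
    then show ?thesis unfolding eq by (rule modular_set_up[OF Y]) (use total in simp)
  qed
  \<comment> \<open>The case \<open>l = 0\<close> controls \<open>v - f\<close>; adding
    \<open>f\<close> back shows that \<open>v\<close> lies in the Orlicz space.\<close>
  have "r + \<kappa> \<in> modular_set lam \<Phi> (\<lambda>x. (v x - f x) + f x)"
    using close[of 0] f vm \<kappa> by (intro modular_set_add[OF Y]) auto
  then have "v \<in> orlicz_fun lam \<Phi>" using modular_set_imp_orlicz[OF vm, of "r + \<kappa>"] by simp
  then show ?thesis using close by blast
qed

lemma class_in_orlicz_space: "f \<in> orlicz_fun lam \<Phi> \<Longrightarrow> orlicz_rel lam \<Phi> `` {f} \<in> orlicz_space lam \<Phi>"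
  unfolding orlicz_space_def by (rule quotientI)

text \<open>Density replaces the centre of a ball inside \<open>U\<close> by a bounded compactly
  supported \<open>f\<close>. Since \<open>f\<close> is within \<open>r / 4\<close> of the centre
  and the iterates of \<open>v\<close> are within \<open>r / 4\<close> of \<open>f\<close>, these
  iterates stay in the ball.\<close>

lemma multiply_recurrent_if_weights_decay:
  assumes lc: "locally_compact_space (euclidean :: 'g topology)" and Y: "young_function \<Phi>"
    and D: "delta2_regular TYPE('g) \<Phi>" and w: "weight w"
    and decay: "\<And>L K. L > 0 \<Longrightarrow> compact K \<Longrightarrow> emeasure lam K > 0 \<Longrightarrow>
      \<exists>(E :: nat \<Rightarrow> 'g set) (n :: nat \<Rightarrow> nat).
         (\<forall>k. E k \<in> sets borel \<and> E k \<subseteq> K) \<and> strict_mono n \<and> (\<forall>k. n k > 0) \<and>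
         (\<lambda>k. emeasure lam (E k)) \<longlonglongrightarrow> emeasure lam K \<and>
         (\<forall>l\<in>{1..L}.
            (\<lambda>k. Linf_norm (restrict_space lam (E k)) (weight_prod a w (l * n k))) \<longlonglongrightarrow> 0 \<and>
            (\<lambda>k. Linf_norm (restrict_space lam (E k)) (weight_prod_tilde a w (l * n k))) \<longlonglongrightarrow> 0)"
  shows "multiply_recurrent (orlicz_topology lam \<Phi>) (orlicz_translation lam \<Phi> a w)"
  unfolding multiply_recurrent_def topspace_orlicz[OF Y]
proof (intro allI impI, elim conjE)
  interpret Metric_space "orlicz_space lam \<Phi>" "orlicz_dist lam \<Phi>" by (rule Metric_space_orlicz[OF Y])
  fix L :: nat and U assume L: "L > 0" and "openin (orlicz_topology lam \<Phi>) U" "U \<noteq> {}"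
  then obtain F r where F: "F \<in> orlicz_space lam \<Phi>" and r: "r > 0" "mball F r \<subseteq> U"
    unfolding orlicz_topology_def openin_mtopology by blast
  obtain f0 where f0: "f0 \<in> orlicz_fun lam \<Phi>" "F = orlicz_rel lam \<Phi> `` {f0}"
    using F by (rule orlicz_space_cases)
  obtain K B f where K: "compact K" and B: "B \<ge> 0" and f: "f \<in> borel_measurable lam"
    and fB: "\<And>x. cmod (f x) \<le> B * indicator K x"
    and f0f: "r / 4 \<in> modular_set lam \<Phi> (\<lambda>x. f0 x - f x)"
    using bounded_compact_support_dense[OF lc Y D f0(1), of "r / 4"] r by auto
  \<comment> \<open>The support \<open>K\<close> may be a null set, whereas the decay condition
    speaks of positive measure. Inner regularity supplies a compact \<open>K0\<close> of positive
    measure with which to enlarge it.\<close>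
  have "emeasure lam UNIV = (SUP K\<in>{K. compact K \<and> K \<subseteq> UNIV}. emeasure lam K)"
    using haar open_UNIV unfolding right_haar_measure_def by blast
  moreover have "emeasure lam UNIV > 0"
    using conjunct1[OF conjunct2[OF haar[unfolded right_haar_measure_def]]]
    by (simp add: zero_less_iff_neq_zero)
  ultimately obtain K0 where K0: "compact K0" "emeasure lam K0 > 0" by (auto simp: less_SUP_iff)
  define K' where "K' = K \<union> K0"
  have K': "compact K'" using K K0 by (auto simp: K'_def)
  have "emeasure lam K0 \<le> emeasure lam K'"
    using K' by (intro emeasure_mono compact_measurable) (auto simp: K'_def)
  then have "emeasure lam K' > 0" using K0 by simp
  from decay[OF L K' this] obtain E and n :: "nat \<Rightarrow> nat"
    where E: "\<forall>k. E k \<in> sets borel \<and> E k \<subseteq> K'" and "strict_mono n" and n: "\<forall>k. n k > 0"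
    and lim: "(\<lambda>k. emeasure lam (E k)) \<longlonglongrightarrow> emeasure lam K'"
    and dec: "\<forall>l\<in>{1..L}.
        (\<lambda>k. Linf_norm (restrict_space lam (E k)) (weight_prod a w (l * n k))) \<longlonglongrightarrow> 0 \<and>
        (\<lambda>k. Linf_norm (restrict_space lam (E k)) (weight_prod_tilde a w (l * n k))) \<longlonglongrightarrow> 0"
    by (elim exE conjE) (rule that; assumption)
  have fB': "cmod (f x) \<le> B * indicator K' x" for x
    by (rule order_trans[OF fB mult_left_mono[OF _ B]]) (auto simp: K'_def indicator_def)
  have "r / 4 > 0" using r(1) by simp
  from recurrence_near_bounded[OF Y w f K' B fB' this E lim dec]
  obtain k v where v: "v \<in> orlicz_fun lam \<Phi>"
    and close: "\<And>l. l \<le> L \<Longrightarrow> r / 4 \<in> modular_set lam \<Phi> (\<lambda>x. (weighted_translation a w ^^ (l * n k)) v x - f x)"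
    by blast
  have "(orlicz_translation lam \<Phi> a w ^^ (l * n k)) (orlicz_rel lam \<Phi> `` {v}) \<in> U" if l: "l \<le> L" for l
  proof -
    let ?v = "(weighted_translation a w ^^ (l * n k)) v"
    have v': "?v \<in> orlicz_fun lam \<Phi>" using orlicz_translation_iter[OF Y w v] by blast
    have "r / 4 + r / 4 \<in> modular_set lam \<Phi> (\<lambda>x. f0 x - ?v x)"
    proof (rule modular_set_diff[OF Y f0f close[OF l]])
      show "cmod (f0 x - ?v x) \<le> cmod (f0 x - f x) + cmod (?v x - f x)" for x
        using norm_triangle_ineq4[of "f0 x - f x" "?v x - f x"] by simp
    qed (use f f0 v' in \<open>auto simp: orlicz_fun_def\<close>)
    then have "luxemburg_norm lam \<Phi> (\<lambda>x. f0 x - ?v x) < r"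
      using modular_imp_lux_le r(1) by fastforce
    then have "orlicz_rel lam \<Phi> `` {?v} \<in> mball F r"
      using f0 v' by (simp add: class_in_orlicz_space orlicz_dist_class)
    then show ?thesis using r(2) orlicz_translation_iter[OF Y w v] by auto
  qed
  then have "orlicz_rel lam \<Phi> `` {v} \<in> (\<Inter>l\<in>{0..L}. {x \<in> orlicz_space lam \<Phi>.
      (orlicz_translation lam \<Phi> a w ^^ (l * n k)) x \<in> U})"
    using class_in_orlicz_space[OF v] by auto
  then show "\<exists>n>0. (\<Inter>l\<in>{0..L}. {x \<in> orlicz_space lam \<Phi>.
      (orlicz_translation lam \<Phi> a w ^^ (l * n)) x \<in> U}) \<noteq> {}"
    using n by blast
qed

section \<open>From multiple recurrence to decaying weights\<close>

text \<open>One step in the construction of the sequences. Where a product exceeds \<epsilon>, some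
  iterate of \<open>f\<close> differs from the indicator of \<open>K\<close> by at least
  \<open>s\<close>, at the point or at its shift; Chebyshev and right invariance make the set of
  such points small.\<close>

lemma recurrent_weights_small:
  assumes lc: "locally_compact_space (euclidean :: 'g topology)" and a: "aperiodic a"
    and Y: "young_function \<Phi>" and w: "weight w" and K: "compact K"
    and MR: "multiply_recurrent (orlicz_topology lam \<Phi>) (orlicz_translation lam \<Phi> a w)"
    and L: "L > 0" and "\<epsilon> > 0"
  obtains n E where "n > N" "E \<in> sets borel" "E \<subseteq> K" "emeasure lam (K - E) \<le> ennreal \<epsilon>"
    "\<And>l x. l \<in> {1..L} \<Longrightarrow> x \<in> E \<Longrightarrow> weight_prod a w (l * n) x \<le> \<epsilon> \<and> weight_prod_tilde a w (l * n) x \<le> \<epsilon>"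
proof -
  interpret Metric_space "orlicz_space lam \<Phi>" "orlicz_dist lam \<Phi>" by (rule Metric_space_orlicz[OF Y])
  have [measurable]: "K \<in> sets lam" using K by (rule compact_measurable)
  obtain N0 where N0: "\<And>n x. n \<ge> N0 \<Longrightarrow> x \<in> K \<Longrightarrow> x + gpow a n \<notin> K"
      "\<And>n x. n \<ge> N0 \<Longrightarrow> x \<in> K \<Longrightarrow> x - gpow a n \<notin> K"
    using aperiodic_translates_disjoint[OF lc a K] by metis
  \<comment> \<open>Any positive multiple of \<open>N'\<close> is at least \<open>N0\<close>, so
    that the shifts leave \<open>K\<close>, and larger than \<open>N\<close>.\<close>
  define N' where "N' = max N0 (Suc N)"
  \<comment> \<open>The bound 1/2 keeps the iterates above 1/2 in modulus at good points of
    \<open>K\<close>; the bound \<open>\<epsilon> / 2\<close> is what a product above \<epsilon>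
    then makes of such a value.\<close>
  define s where "s = min (1 / 2) (\<epsilon> / 2)"
  \<comment> \<open>Each of the \<open>L\<close> values of \<open>l\<close> contributes four
    exceptional sets of measure at most \<eta>.\<close>
  define \<eta> where "\<eta> = \<epsilon> / (4 * real L)"
  have "s > 0" "\<eta> > 0" using \<open>\<epsilon> > 0\<close> L by (auto simp: s_def \<eta>_def)
  then obtain \<delta> where \<delta>: "\<delta> > 0" and small: "\<And>f. f \<in> borel_measurable lam \<Longrightarrow> \<delta> \<in> modular_set lam \<Phi> f \<Longrightarrow>
      emeasure lam {x \<in> space lam. s \<le> cmod (f x)} \<le> ennreal \<eta>"
    using modular_small_imp_measure_small[OF Y] by metis
  define \<psi> where "\<psi> x = complex_of_real (indicator K x)" for x
  have [measurable]: "\<psi> \<in> borel_measurable lam" unfolding \<psi>_def by measurable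
  have \<psi>: "\<psi> \<in> orlicz_fun lam \<Phi>"
    by (rule orlicz_fun_of_bounded[OF Y _ K, of _ 1]) (auto simp: \<psi>_def)
  define U where "U = mball (orlicz_rel lam \<Phi> `` {\<psi>}) \<delta>"
  have Uo: "openin (orlicz_topology lam \<Phi>) U" unfolding U_def orlicz_topology_def by (rule openin_mball)
  have "orlicz_rel lam \<Phi> `` {\<psi>} \<in> U"
    unfolding U_def using \<delta> class_in_orlicz_space[OF \<psi>] by simp
  then have Une: "U \<noteq> {}" by blast
  have LN: "L * N' > 0" using L by (simp add: N'_def)
  note MR' = MR[unfolded multiply_recurrent_def topspace_orlicz[OF Y]]
  obtain n0 where n0: "n0 > 0" and ne: "(\<Inter>l\<in>{0..L * N'}. {x \<in> orlicz_space lam \<Phi>.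
      (orlicz_translation lam \<Phi> a w ^^ (l * n0)) x \<in> U}) \<noteq> {}"
    using MR'[rule_format, OF LN conjI[OF Uo Une]] by (elim exE conjE)
  obtain F where "F \<in> (\<Inter>l\<in>{0..L * N'}. {x \<in> orlicz_space lam \<Phi>.
      (orlicz_translation lam \<Phi> a w ^^ (l * n0)) x \<in> U})"
    using ne by (meson ex_in_conv)
  then have F: "F \<in> orlicz_space lam \<Phi> \<and> (orlicz_translation lam \<Phi> a w ^^ (l * n0)) F \<in> U"
    if "l \<le> L * N'" for l using that by simp
  obtain f where f: "f \<in> orlicz_fun lam \<Phi>" "F = orlicz_rel lam \<Phi> `` {f}"
    using F[of 0] by (metis le0 orlicz_space_cases)
  have [measurable]: "f \<in> borel_measurable lam" using f by (simp add: orlicz_fun_def)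
  \<comment> \<open>Since \<open>l * n = (l * N') * n0\<close>, the recurrence obtained for the
    bound \<open>L * N'\<close> covers all iterates of order \<open>l * n\<close> with
    \<open>l\<close> \<le> \<open>L\<close>.\<close>
  define n where "n = N' * n0"
  have n: "n \<ge> N'" using n0 by (simp add: n_def)
  define p where "p l = (weighted_translation a w ^^ (l * n)) f" for l
  have p: "p l \<in> orlicz_fun lam \<Phi>" for l
    unfolding p_def using orlicz_translation_iter[OF Y w f(1)] by blast
  then have [measurable]: "p l \<in> borel_measurable lam" for l by (simp add: orlicz_fun_def)
  define Z where "Z l = {x. s \<le> cmod (\<psi> x - p l x)}" for l
  have Zm [measurable]: "Z l \<in> sets lam" for l
  proof -
    have "{x \<in> space lam. s \<le> cmod (\<psi> x - p l x)} \<in> sets lam" by measurable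
    then show ?thesis by (simp add: Z_def)
  qed
  have Z: "emeasure lam (Z l) \<le> ennreal \<eta>" if "l \<le> L" for l
  proof -
    have "orlicz_rel lam \<Phi> `` {p l} \<in> U"
      using F[of "l * N'"] that orlicz_translation_iter[OF Y w f(1), of "l * n" a]
      by (simp add: p_def n_def f mult.assoc)
    then have "luxemburg_norm lam \<Phi> (\<lambda>x. \<psi> x - p l x) < \<delta>"
      using \<psi> p by (simp add: U_def orlicz_dist_class)
    then have "\<delta> \<in> modular_set lam \<Phi> (\<lambda>x. \<psi> x - p l x)"
      by (intro lux_less_imp_modular[OF Y] orlicz_diff[OF Y] \<psi> p)
    then show ?thesis using small[of "\<lambda>x. \<psi> x - p l x"] by (simp add: Z_def)
  qed
  \<comment> \<open>The first pair of sets serves \<open>weight_prod\<close>, which leads from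
    iterate 0 at \<open>x\<close> to iterate \<open>l\<close> at the forward shift. The second
    serves \<open>weight_prod_tilde\<close>, which leads from iterate \<open>l\<close> at
    \<open>x\<close> to iterate 0 at the backward shift.\<close>
  define C where "C l = (Z 0 \<union> {x. x + gpow a (l * n) \<in> Z l}) \<union> (Z l \<union> {x. x + - gpow a (l * n) \<in> Z 0})" for l
  have shift_Z: "{x. x + g \<in> Z l} \<in> sets lam" "emeasure lam {x. x + g \<in> Z l} = emeasure lam (Z l)" for g l
    using measurable_sets[OF shift_measurable Zm, of g l] emeasure_shift[of "\<lambda>x. x \<in> Z l" g] Zm
    by (auto simp: vimage_def)
  have Cm: "C l \<in> sets lam" for l unfolding C_def by (intro sets.Un shift_Z Zm)
  have C: "emeasure lam (C l) \<le> ennreal (4 * \<eta>)" if "l \<le> L" for l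
  proof -
    have "emeasure lam (C l) \<le> (emeasure lam (Z 0) + emeasure lam (Z l)) + (emeasure lam (Z l) + emeasure lam (Z 0))"
      unfolding C_def
      by (intro order_trans[OF emeasure_subadditive] add_mono sets.Un shift_Z Zm
          eq_refl[OF shift_Z(2)] order_refl)
    also have "\<dots> \<le> (ennreal \<eta> + ennreal \<eta>) + (ennreal \<eta> + ennreal \<eta>)"
      using that by (intro add_mono Z) auto
    also have "\<dots> = ennreal (4 * \<eta>)" using \<open>\<eta> > 0\<close> by (simp flip: ennreal_plus)
    finally show ?thesis .
  qed
  have half: "cmod (p l x) > 1 / 2" if "x \<in> K" "x \<notin> Z l" for l x
  proof -
    have "cmod (1 - p l x) < 1 / 2" using that by (auto simp: Z_def \<psi>_def s_def)
    moreover have "1 \<le> cmod (1 - p l x) + cmod (p l x)"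
      using norm_triangle_ineq[of "1 - p l x" "p l x"] by simp
    ultimately show ?thesis by simp
  qed
  \<comment> \<open>At a good \<open>x\<close> in \<open>K\<close> the value \<open>p i x\<close>
    exceeds 1/2 in modulus, so a factor above \<epsilon> makes |p j y| at least \<open>s\<close>,
    although \<psi> vanishes at \<open>y\<close>.\<close>
  have in_Z: "y \<in> Z j" if "y \<notin> K" "p j y = of_real c * p i x" "c > \<epsilon>" "x \<in> K" "x \<notin> Z i" for x y i j c
  proof -
    have "\<epsilon> * (1 / 2) \<le> c * cmod (p i x)"
      using half[OF that(4,5)] that(3) \<open>\<epsilon> > 0\<close> by (intro mult_mono) auto
    then have "s \<le> cmod (p j y)" using that(2,3) \<open>\<epsilon> > 0\<close> by (simp add: norm_mult s_def)
    then show ?thesis using that(1) by (simp add: Z_def \<psi>_def)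
  qed
  define E where "E = {x \<in> K. \<forall>l\<in>{1..L}. weight_prod a w (l * n) x \<le> \<epsilon> \<and> weight_prod_tilde a w (l * n) x \<le> \<epsilon>}"
  note [measurable] = weight_prod_measurable[OF w] weight_prod_tilde_measurable[OF w]
  have "{x \<in> space lam. x \<in> K \<and> (\<forall>l\<in>{1..L}. weight_prod a w (l * n) x \<le> \<epsilon> \<and> weight_prod_tilde a w (l * n) x \<le> \<epsilon>)} \<in> sets lam"
    by measurable
  then have Em: "E \<in> sets lam" by (simp add: E_def)
  have "K - E \<subseteq> (\<Union>l\<in>{1..L}. C l)"
  proof
    fix x assume "x \<in> K - E"
    then obtain l where x: "x \<in> K" and l: "l \<in> {1..L}"
      and big: "weight_prod a w (l * n) x > \<epsilon> \<or> weight_prod_tilde a w (l * n) x > \<epsilon>"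
      by (auto simp: E_def not_le)
    have ln: "l * n \<ge> N0"
    proof -
      have "1 * n \<le> l * n" using l by (intro mult_le_mono1) auto
      moreover have "N0 \<le> n" using n by (simp add: N'_def)
      ultimately show ?thesis by linarith
    qed
    have "x \<in> C l" using big
    proof
      assume "weight_prod a w (l * n) x > \<epsilon>"
      moreover have "p l (x + gpow a (l * n)) = of_real (weight_prod a w (l * n) x) * p 0 x"
        unfolding p_def by (simp add: translation_iter)
      ultimately have "x \<in> Z 0 \<or> x + gpow a (l * n) \<in> Z l" using in_Z N0(1)[OF ln x] x by blast
      then show ?thesis by (auto simp: C_def)
    next
      assume "weight_prod_tilde a w (l * n) x > \<epsilon>"
      moreover have "p 0 (x - gpow a (l * n)) = of_real (weight_prod_tilde a w (l * n) x) * p l x"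
      proof -
        have "w x > 0" for x using w by (simp add: weight_def)
        note inv = translation_cotranslation(2)[of w a, OF this]
        have "(weighted_cotranslation a w ^^ (l * n)) (p l) = p 0"
          unfolding p_def by (simp add: funpow_left_inverse[of "weighted_cotranslation a w", OF inv])
        then show ?thesis by (metis cotranslation_iter)
      qed
      ultimately have "x \<in> Z l \<or> x - gpow a (l * n) \<in> Z 0" using in_Z N0(2)[OF ln x] x by blast
      then show ?thesis by (auto simp: C_def)
    qed
    then show "x \<in> (\<Union>l\<in>{1..L}. C l)" using l by blast
  qed
  then have "emeasure lam (K - E) \<le> emeasure lam (\<Union>l\<in>{1..L}. C l)"
    using Cm by (intro emeasure_mono) auto
  also have "\<dots> \<le> (\<Sum>l\<in>{1..L}. emeasure lam (C l))"
    using Cm by (intro emeasure_subadditive_finite) auto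
  also have "\<dots> \<le> (\<Sum>l\<in>{1..L}. ennreal (4 * \<eta>))" by (intro sum_mono C) auto
  also have "\<dots> = ennreal \<epsilon>"
    using L \<open>\<epsilon> > 0\<close> by (simp add: \<eta>_def ennreal_of_nat_eq_real_of_nat flip: ennreal_mult)
  finally have KE: "emeasure lam (K - E) \<le> ennreal \<epsilon>" .
  show thesis
  proof (rule that[of n E])
    show "n > N" using n by (simp add: N'_def)
  qed (use Em KE in \<open>auto simp: E_def sets_lam\<close>)
qed

section \<open>Extraction of the sets and exponents\<close>

lemma emeasure_tendsto_of_diff:
  assumes "K \<in> sets M" "emeasure M K < \<infinity>" and E: "\<And>k. E k \<in> sets M" "\<And>k. E k \<subseteq> K"
    and lim: "(\<lambda>k. emeasure M (K - E k)) \<longlonglongrightarrow> 0"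
  shows "(\<lambda>k. emeasure M (E k)) \<longlonglongrightarrow> emeasure M K"
proof -
  have "emeasure M (E k) = emeasure M K - emeasure M (K - E k)" for k
  proof -
    have "emeasure M (K - E k) \<le> emeasure M K" using assms(1) by (intro emeasure_mono) auto
    then have "emeasure M (K - (K - E k)) = emeasure M K - emeasure M (K - E k)"
      using assms by (intro emeasure_Diff) (auto simp: top_unique)
    moreover have "K - (K - E k) = E k" using E(2) by blast
    ultimately show ?thesis by simp
  qed
  moreover have "(\<lambda>k. emeasure M K - emeasure M (K - E k)) \<longlonglongrightarrow> emeasure M K - 0"
    using assms(2) by (intro tendsto_diff_ennreal lim tendsto_const) auto
  ultimately show ?thesis by simp
qed

lemma Linf_norm_restrict_le:
  assumes [measurable]: "c \<in> borel_measurable lam" and le: "\<And>x. x \<in> E \<Longrightarrow> \<bar>c x\<bar> \<le> \<epsilon>"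
  shows "Linf_norm (restrict_space lam E) c \<le> ennreal \<epsilon>"
proof -
  have "(\<lambda>x. ennreal \<bar>c x\<bar>) \<in> borel_measurable (restrict_space lam E)"
    by (rule measurable_restrict_space1) measurable
  then show ?thesis unfolding Linf_norm_def
    using le by (intro esssup_I AE_I2) (auto simp: space_restrict_space intro!: ennreal_leI)
qed

text \<open>The single step is applied with tolerance \<open>1 / (k + 1)\<close> and with the
  preceding exponent as lower bound, which makes the exponents strictly increasing; all limits then
  follow by comparison with the tolerances.\<close>

lemma weights_decay_if_multiply_recurrent:
  assumes lc: "locally_compact_space (euclidean :: 'g topology)" and a: "aperiodic a"
    and Y: "young_function \<Phi>" and w: "weight w" and K: "compact K"
    and MR: "multiply_recurrent (orlicz_topology lam \<Phi>) (orlicz_translation lam \<Phi> a w)"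
    and L: "L > 0"
  shows "\<exists>(E :: nat \<Rightarrow> 'g set) (n :: nat \<Rightarrow> nat).
         (\<forall>k. E k \<in> sets borel \<and> E k \<subseteq> K) \<and> strict_mono n \<and> (\<forall>k. n k > 0) \<and>
         (\<lambda>k. emeasure lam (E k)) \<longlonglongrightarrow> emeasure lam K \<and>
         (\<forall>l\<in>{1..L}.
            (\<lambda>k. Linf_norm (restrict_space lam (E k)) (weight_prod a w (l * n k))) \<longlonglongrightarrow> 0 \<and>
            (\<lambda>k. Linf_norm (restrict_space lam (E k)) (weight_prod_tilde a w (l * n k))) \<longlonglongrightarrow> 0)"
proof -
  define e where "e k = 1 / real (Suc k)" for k
  define P where "P k q \<longleftrightarrow> fst q > 0 \<and> snd q \<in> sets borel \<and> snd q \<subseteq> K \<and>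
      emeasure lam (K - snd q) \<le> ennreal (e k) \<and>
      (\<forall>l\<in>{1..L}. \<forall>x\<in>snd q. weight_prod a w (l * fst q) x \<le> e k \<and> weight_prod_tilde a w (l * fst q) x \<le> e k)"
    for k and q :: "nat \<times> 'g set"
  have step: "\<exists>q. P k q \<and> fst q > N" for k N
  proof -
    have "e k > 0" by (simp add: e_def)
    then obtain n E where "n > N" "E \<in> sets borel" "E \<subseteq> K" "emeasure lam (K - E) \<le> ennreal (e k)"
      "\<And>l x. l \<in> {1..L} \<Longrightarrow> x \<in> E \<Longrightarrow> weight_prod a w (l * n) x \<le> e k \<and> weight_prod_tilde a w (l * n) x \<le> e k"
      using recurrent_weights_small[OF lc a Y w K MR L] by metis
    then show ?thesis by (intro exI[of _ "(n, E)"]) (auto simp: P_def)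
  qed
  \<comment> \<open>Dependent choice is used because the next exponent must exceed the one already
    chosen.\<close>
  have "\<exists>q. \<forall>k. P k (q k) \<and> fst (q k) < fst (q (Suc k))"
    by (rule dependent_nat_choice) (use step in blast)+
  then obtain q where q: "\<And>k. P k (q k)" "\<And>k. fst (q k) < fst (q (Suc k))" by blast
  define n where "n k = fst (q k)" for k
  define E where "E k = snd (q k)" for k
  have nE: "n k > 0" "E k \<in> sets borel" "E k \<subseteq> K" "emeasure lam (K - E k) \<le> ennreal (e k)"
    "\<And>l x. l \<in> {1..L} \<Longrightarrow> x \<in> E k \<Longrightarrow> weight_prod a w (l * n k) x \<le> e k"
    "\<And>l x. l \<in> {1..L} \<Longrightarrow> x \<in> E k \<Longrightarrow> weight_prod_tilde a w (l * n k) x \<le> e k" for k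
    using q(1)[of k] by (auto simp: P_def n_def E_def)
  have "e \<longlonglongrightarrow> 0" unfolding e_def using LIMSEQ_inverse_real_of_nat by (simp add: inverse_eq_divide)
  then have e0: "(\<lambda>k. ennreal (e k)) \<longlonglongrightarrow> 0" using tendsto_ennrealI by fastforce
  have squeeze: "u \<longlonglongrightarrow> 0" if "\<And>k. u k \<le> ennreal (e k)" for u
    by (rule tendsto_sandwich[OF _ _ tendsto_const e0]) (auto simp: that)
  show ?thesis
  proof (intro exI conjI allI ballI)
    show "E k \<in> sets borel" "E k \<subseteq> K" "n k > 0" for k by (fact nE)+
    show "strict_mono n" using q(2) by (auto simp: strict_mono_Suc_iff n_def)
    show "(\<lambda>k. emeasure lam (E k)) \<longlonglongrightarrow> emeasure lam K"
      by (rule emeasure_tendsto_of_diff[OF compact_measurable[OF K] emeasure_compact[OF K] _ nE(3)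
            squeeze[OF nE(4)]]) (simp add: sets_lam nE(2))
    fix l assume l: "l \<in> {1..L}"
    show "(\<lambda>k. Linf_norm (restrict_space lam (E k)) (weight_prod a w (l * n k))) \<longlonglongrightarrow> 0"
      using nE(5)[OF l] weight_prod_pos[OF w]
      by (intro squeeze Linf_norm_restrict_le weight_prod_measurable w) (simp add: abs_of_pos)
    show "(\<lambda>k. Linf_norm (restrict_space lam (E k)) (weight_prod_tilde a w (l * n k))) \<longlonglongrightarrow> 0"
      using nE(6)[OF l] weight_prod_tilde_pos[OF w]
      by (intro squeeze Linf_norm_restrict_le weight_prod_tilde_measurable w) (simp add: abs_of_pos)
  qed
qed

end

theorem theorem2p2:
  fixes lam :: "'g::{topological_group_add, t2_space, second_countable_topology} measure"
    and a :: 'g and w :: "'g \<Rightarrow> real" and \<Phi> :: "real \<Rightarrow> real"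
  assumes "locally_compact_space (euclidean :: 'g topology)"
    and "right_haar_measure lam"
    and "aperiodic a"
    and "weight w" and "w \<in> Linf lam" and "(\<lambda>x. inverse (w x)) \<in> Linf lam"
    and "young_function \<Phi>" and "delta2_regular TYPE('g) \<Phi>"
  shows "multiply_recurrent (orlicz_topology lam \<Phi>) (orlicz_translation lam \<Phi> a w) \<longleftrightarrow>
    (\<forall>L::nat. \<forall>K. L > 0 \<and> compact K \<and> emeasure lam K > 0 \<longrightarrow>
      (\<exists>(E :: nat \<Rightarrow> 'g set) (n :: nat \<Rightarrow> nat).
         (\<forall>k. E k \<in> sets borel \<and> E k \<subseteq> K) \<and> strict_mono n \<and> (\<forall>k. n k > 0) \<and>
         (\<lambda>k. emeasure lam (E k)) \<longlonglongrightarrow> emeasure lam K \<and>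
         (\<forall>l\<in>{1..L}.
            (\<lambda>k. Linf_norm (restrict_space lam (E k)) (weight_prod a w (l * n k))) \<longlonglongrightarrow> 0 \<and>
            (\<lambda>k. Linf_norm (restrict_space lam (E k)) (weight_prod_tilde a w (l * n k))) \<longlonglongrightarrow> 0)))"
proof -
  interpret right_haar lam by unfold_locales fact
  show ?thesis
    using multiply_recurrent_if_weights_decay[OF assms(1,7,8,4), of a]
      weights_decay_if_multiply_recurrent[OF assms(1,3,7,4)]
    by (intro iffI allI impI) blast+
qed


end
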